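(* A directed graph $G=(V,E)$ satisfies property (P1) if and only if $G$ does not contain a subgraph that is a subdivision of the directed graph $W$.
   Context: All graphs are simple. A directed graph $G$ is a directed $s$-$t$-series-parallel graph ($s$-$t$-DSP) iff it is a single edge $st$, or it arises from the disjoint union of a directed $s_1$-$t_1$-series-parallel graph $G_1$ and a directed $s_2$-$t_2$-series-parallel graph $G_2$ by one of: (P-composition) identify $s_1$ with $s_2$ and $t_1$ with $t_2$, then $s=s_1,t=t_1$; (S-composition) identify $t_1$ with $s_2$, then $s=s_1,t=t_2$. For vertices $u,v$ of $G$, $P_G(u,v)$ denotes the subgraph of $G$ induced by the edges lying on directed $u$-$v$-paths (paths have no repeated vertices). Property (P1): for every $(s,t)\in V^2$, $P_G(s,t)$ is either an $s$-$t$-DSP or contains no edges. $W$ is the directed graph with vertices $a,b,c,d$ and edges $ab, ac, bd, cd, bc$. A subdivision of $W$ is obtained by replacing each edge $xy$ of $W$ by a directed $x$-$y$-path of length at least $1$, these paths being internally vertex-disjoint. *)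

theory Defs
  imports "Graph_Theory.Pair_Digraph" "Graph_Theory.Digraph_Component"
begin

(* A composition is rendered in place: gluing disjoint copies along terminals amounts to taking the
   union of two digraphs that share exactly the identified vertices. The arc-disjointness condition
   in the parallel case excludes gluing two digraphs that both contain the arc (s, t), which would
   create a pair of parallel arcs. *)
inductive dsp :: "'a \<Rightarrow> 'a \<Rightarrow> 'a pair_pre_digraph \<Rightarrow> bool" where
  edge: "s \<noteq> t \<Longrightarrow> dsp s t \<lparr> pverts = {s, t}, parcs = {(s, t)} \<rparr>"
| parallel: "\<lbrakk> dsp s t G1; dsp s t G2;
      pverts G1 \<inter> pverts G2 = {s, t}; parcs G1 \<inter> parcs G2 = {} \<rbrakk>
    \<Longrightarrow> dsp s t \<lparr> pverts = pverts G1 \<union> pverts G2, parcs = parcs G1 \<union> parcs G2 \<rparr>"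
| series: "\<lbrakk> dsp s m G1; dsp m t G2; pverts G1 \<inter> pverts G2 = {m} \<rbrakk>
    \<Longrightarrow> dsp s t \<lparr> pverts = pverts G1 \<union> pverts G2, parcs = parcs G1 \<union> parcs G2 \<rparr>"

definition path_arcs :: "'a pair_pre_digraph \<Rightarrow> 'a \<Rightarrow> 'a \<Rightarrow> 'a rel" where
  "path_arcs G u v = {e. \<exists>p. pre_digraph.apath (with_proj G) u p v \<and> e \<in> set p}"

definition path_subgraph :: "'a pair_pre_digraph \<Rightarrow> 'a \<Rightarrow> 'a \<Rightarrow> 'a pair_pre_digraph" where
  "path_subgraph G u v = \<lparr> pverts = Field (path_arcs G u v), parcs = path_arcs G u v \<rparr>"

definition property_P1 :: "'a pair_pre_digraph \<Rightarrow> bool" where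
  "property_P1 G \<longleftrightarrow> (\<forall>s \<in> pverts G. \<forall>t \<in> pverts G.
     dsp s t (path_subgraph G s t) \<or> parcs (path_subgraph G s t) = {})"

datatype W_vertex = Wa | Wb | Wc | Wd

definition W :: "W_vertex pair_pre_digraph" where
  "W = \<lparr> pverts = {Wa, Wb, Wc, Wd},
         parcs = {(Wa, Wb), (Wa, Wc), (Wb, Wd), (Wc, Wd), (Wb, Wc)} \<rparr>"

definition inner_verts :: "('a \<times> 'a) awalk \<Rightarrow> 'a \<Rightarrow> 'a \<Rightarrow> 'a set" where
  "inner_verts p u v = set (pawalk_verts u p) - {u, v}"

(* H is a subdivision of K: f places the vertices of K in H, and P (x, y) is the directed path
   replacing the arc (x, y). The subdivision notion of Graph_Theory is restricted to bidirected
   digraphs. *)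
definition subdivision_of :: "'k pair_pre_digraph \<Rightarrow> 'a pair_pre_digraph \<Rightarrow> bool" where
  "subdivision_of K H \<longleftrightarrow> (\<exists>(f :: 'k \<Rightarrow> 'a) (P :: 'k \<times> 'k \<Rightarrow> ('a \<times> 'a) awalk).
     inj_on f (pverts K) \<and>
     (\<forall>(x, y) \<in> parcs K. P (x, y) \<noteq> [] \<and>
        pre_digraph.apath (with_proj H) (f x) (P (x, y)) (f y) \<and>
        inner_verts (P (x, y)) (f x) (f y) \<inter> f ` pverts K = {}) \<and>
     (\<forall>(x, y) \<in> parcs K. \<forall>(x', y') \<in> parcs K. (x, y) \<noteq> (x', y') \<longrightarrow>
        inner_verts (P (x, y)) (f x) (f y) \<inter> inner_verts (P (x', y')) (f x') (f y') = {}) \<and>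
     pverts H = f ` pverts K \<union> (\<Union>(x, y) \<in> parcs K. set (pawalk_verts (f x) (P (x, y)))) \<and>
     parcs H = (\<Union>e \<in> parcs K. set (P e)))"

end

theory Submission
  imports Defs
begin

text \<open>For one direction, every arc of a subdivided \<open>W\<close> with corners \<open>a, b, c, d\<close> lies on an \<open>a\<close>-\<open>d\<close>-path,
  so \<open>W\<close> would sit inside a series-parallel digraph with terminals \<open>a\<close> and \<open>d\<close>. A parallel composition
  would confine it to one side, and a series composition has a cut vertex, which cannot lie on two internally
  disjoint paths.

  Conversely, take a maximal \<open>s\<close>-\<open>t\<close>-series-parallel subgraph \<open>M\<close> of a \<open>W\<close>-free digraph. Adding an ear from
  \<open>u\<close> to \<open>v\<close>, where \<open>v\<close> does not reach \<open>u\<close> in \<open>M\<close>, either keeps \<open>M\<close> series-parallel or creates a \<open>W\<close>,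
  so all ears lead backwards in the acyclic order of \<open>M\<close>. If an \<open>s\<close>-\<open>t\<close>-path first leaves \<open>M\<close> at \<open>u\<close>, it must
  therefore cross from the predecessors of \<open>u\<close> to the rest of \<open>M\<close> along an arc \<open>(x, y)\<close> of \<open>M\<close>. The path from
  \<open>s\<close> to \<open>u\<close> avoiding \<open>x\<close>, the path from \<open>x\<close> to \<open>t\<close> through \<open>y\<close> and a path from \<open>x\<close> to \<open>u\<close> then yield a \<open>W\<close>.
  Hence \<open>M\<close> contains all \<open>s\<close>-\<open>t\<close>-paths.\<close>

section \<open>Reachability\<close>

lemma rtrancl_Restr_mono: "(u, v) \<in> (Restr E X)\<^sup>* \<Longrightarrow> X \<subseteq> Y \<Longrightarrow> (u, v) \<in> (Restr E Y)\<^sup>*"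
  by (rule subsetD[OF rtrancl_mono[of "Restr E X" "Restr E Y"]]) auto

lemma rtrancl_subsetD: "(u, v) \<in> F\<^sup>* \<Longrightarrow> F \<subseteq> E \<Longrightarrow> (u, v) \<in> E\<^sup>*"
  using rtrancl_mono by blast

lemma rtrancl_Field: "(u, v) \<in> E\<^sup>* \<Longrightarrow> u \<noteq> v \<Longrightarrow> u \<in> Field E \<and> v \<in> Field E"
  by (metis FieldI1 FieldI2 converse_rtranclE rtranclE)

lemma rtrancl_outside_Field: "(u, v) \<in> E\<^sup>* \<Longrightarrow> u \<notin> Domain E \<or> v \<notin> Range E \<Longrightarrow> u = v"
  by (metis DomainI RangeI converse_rtranclE rtranclE)

text \<open>Every vertex of an \<open>F\<close>-path from \<open>u\<close> to \<open>v\<close> is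
  reached from \<open>u\<close> and reaches \<open>v\<close>, so a set containing this whole
  interval confines the path. This yields paths inside prescribed vertex sets without naming a
  path.\<close>

lemma rtrancl_in_Restr_interval:
  assumes "(u, v) \<in> F\<^sup>*" "F \<subseteq> E" "\<And>w. (u, w) \<in> F\<^sup>* \<Longrightarrow> (w, v) \<in> F\<^sup>* \<Longrightarrow> w \<in> X"
  shows "(u, v) \<in> (Restr E X)\<^sup>*"
proof -
  have "(w, v) \<in> F\<^sup>* \<Longrightarrow> (u, w) \<in> F\<^sup>* \<Longrightarrow> (w, v) \<in> (Restr E X)\<^sup>*" for w
  proof (induction rule: converse_rtrancl_induct)
    case (step y z)
    have "(u, z) \<in> F\<^sup>*" "(y, v) \<in> F\<^sup>*"
      using step by (meson converse_rtrancl_into_rtrancl rtrancl_into_rtrancl)+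
    then have "(y, z) \<in> Restr E X" using step assms(2,3) by blast
    then show ?case using step.IH \<open>(u, z) \<in> F\<^sup>*\<close> by (meson converse_rtrancl_into_rtrancl)
  qed simp
  then show ?thesis using assms(1) by blast
qed

text \<open>Constraining only the heads of arcs lets the path start at \<open>a\<close> in
  \<open>Y\<close> while every later vertex lies outside \<open>Y\<close>. The counterpart
  \<open>rtrancl_first_in\<close> constrains the tails, so that only the final vertex lies in
  \<open>Y\<close>.\<close>

lemma rtrancl_last_in:
  assumes "(u, v) \<in> E\<^sup>*" "u \<in> Y"
  obtains a where "a \<in> Y" "(u, a) \<in> E\<^sup>*" "(a, v) \<in> (E \<inter> UNIV \<times> - Y)\<^sup>*"
proof -
  have "\<exists>a\<in>Y. (u, a) \<in> E\<^sup>* \<and> (a, v) \<in> (E \<inter> UNIV \<times> - Y)\<^sup>*"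
    using assms(1)
  proof (induction rule: rtrancl_induct)
    case base
    then show ?case using assms(2) by blast
  next
    case (step y z)
    show ?case
    proof (cases "z \<in> Y")
      case True
      then show ?thesis using step by (meson rtrancl.rtrancl_refl rtrancl_into_rtrancl)
    next
      case False
      then show ?thesis using step
        by (metis (no_types, lifting) ComplI IntI SigmaI UNIV_I rtrancl.rtrancl_into_rtrancl)
    qed
  qed
  then show ?thesis using that by blast
qed

lemma rtrancl_first_in:
  assumes "(u, v) \<in> E\<^sup>*" "v \<in> Y"
  obtains a where "a \<in> Y" "(u, a) \<in> (E \<inter> (- Y) \<times> UNIV)\<^sup>*" "(a, v) \<in> E\<^sup>*"
proof -
  have "\<exists>a\<in>Y. (u, a) \<in> (E \<inter> (- Y) \<times> UNIV)\<^sup>* \<and> (a, v) \<in> E\<^sup>*"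
    using assms(1)
  proof (induction rule: converse_rtrancl_induct)
    case base
    then show ?case using assms(2) by blast
  next
    case (step y z)
    show ?case
    proof (cases "y \<in> Y")
      case True
      then show ?thesis using step by (meson rtrancl.rtrancl_refl converse_rtrancl_into_rtrancl)
    next
      case False
      then show ?thesis using step
        by (metis (no_types, lifting) ComplI IntI SigmaI UNIV_I converse_rtrancl_into_rtrancl)
    qed
  qed
  then show ?thesis using that by blast
qed

text \<open>\<open>Y\<close> collects the vertices of one walk, so any two of them are joined inside
  \<open>Y\<close> in one direction or the other. When \<open>E\<close> is acyclic, reachability
  decides the direction, and segments of the walk can be recovered from \<open>Y\<close>
  alone.\<close>

lemma rtrancl_chain:
  assumes "(u, v) \<in> (Restr E A)\<^sup>*" "u \<in> A"
  obtains Y where "Y \<subseteq> A" "u \<in> Y" "v \<in> Y"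
    "\<And>y. y \<in> Y \<Longrightarrow> (u, y) \<in> (Restr E Y)\<^sup>*" "\<And>y. y \<in> Y \<Longrightarrow> (y, v) \<in> (Restr E Y)\<^sup>*"
    "\<And>y z. y \<in> Y \<Longrightarrow> z \<in> Y \<Longrightarrow> (y, z) \<in> (Restr E Y)\<^sup>* \<or> (z, y) \<in> (Restr E Y)\<^sup>*"
proof -
  have "\<exists>Y\<subseteq>A. u \<in> Y \<and> v \<in> Y \<and>
    (\<forall>y\<in>Y. (u, y) \<in> (Restr E Y)\<^sup>* \<and> (y, v) \<in> (Restr E Y)\<^sup>* \<and>
      (\<forall>z\<in>Y. (y, z) \<in> (Restr E Y)\<^sup>* \<or> (z, y) \<in> (Restr E Y)\<^sup>*))"
    using assms(1)
  proof (induction rule: rtrancl_induct)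
    case base
    then show ?case using assms(2) by (intro exI[of _ "{u}"]) auto
  next
    case (step v w)
    then obtain Y where Y: "Y \<subseteq> A" "u \<in> Y" "v \<in> Y"
      "\<And>y. y \<in> Y \<Longrightarrow> (u, y) \<in> (Restr E Y)\<^sup>*" "\<And>y. y \<in> Y \<Longrightarrow> (y, v) \<in> (Restr E Y)\<^sup>*"
      "\<And>y z. y \<in> Y \<Longrightarrow> z \<in> Y \<Longrightarrow> (y, z) \<in> (Restr E Y)\<^sup>* \<or> (z, y) \<in> (Restr E Y)\<^sup>*"
      by blast
    let ?Y = "insert w Y"
    have sub: "(y, z) \<in> (Restr E ?Y)\<^sup>*" if "(y, z) \<in> (Restr E Y)\<^sup>*" for y z
      using that rtrancl_mono[of "Restr E Y" "Restr E ?Y"] by blast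
    have vw: "(v, w) \<in> Restr E ?Y" using step(2) Y(3) by blast
    have yw: "(y, w) \<in> (Restr E ?Y)\<^sup>*" if "y \<in> ?Y" for y
      using that sub[OF Y(5)] vw by (cases "y = w") (auto intro: rtrancl_into_rtrancl)
    show ?case
    proof (intro exI[of _ ?Y] conjI ballI)
      show "?Y \<subseteq> A" using Y(1) step(2) by auto
      show "(u, y) \<in> (Restr E ?Y)\<^sup>*" if "y \<in> ?Y" for y
        using that sub[OF Y(4)] yw[of u] Y(2) by (cases "y = w") auto
      show "(y, z) \<in> (Restr E ?Y)\<^sup>* \<or> (z, y) \<in> (Restr E ?Y)\<^sup>*" if "y \<in> ?Y" "z \<in> ?Y" for y z
        using that yw sub Y(6)[of y z] by (cases "y = w"; cases "z = w") auto
    qed (use Y(2) yw in auto)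
  qed
  then show ?thesis using that by blast
qed

section \<open>Acyclicity of compositions\<close>

text \<open>Arcs of \<open>B\<close> never enter \<open>u\<close> and never leave \<open>v\<close>,
  so a walk passes from \<open>A\<close> into \<open>B\<close> only at \<open>u\<close> and returns
  only at \<open>v\<close>. A cycle using both parts would therefore contain an
  \<open>A\<close>-path from \<open>v\<close> to \<open>u\<close>. Parallel composition, series
  composition and the addition of an ear are all instances.\<close>

lemma acyclic_Un_disjoint:
  assumes "acyclic A" "acyclic B" "Field A \<inter> Field B \<subseteq> {u, v}"
    "u \<notin> Range B" "v \<notin> Domain B" "(v, u) \<notin> A\<^sup>*"
  shows "acyclic (A \<union> B)"
proof -
  \<comment> \<open>One block of \<open>B\<close>-arcs suffices: a second block would have to begin
    at \<open>u\<close> after the first had ended at \<open>v\<close>.\<close>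
  have decomp: "\<exists>y z. (x, y) \<in> A\<^sup>* \<and> (y, z) \<in> B\<^sup>* \<and> (z, w) \<in> A\<^sup>*"
    if "(x, w) \<in> (A \<union> B)\<^sup>*" for x w
    using that
  proof (induction rule: rtrancl_induct)
    case (step w w')
    then obtain y z where yz: "(x, y) \<in> A\<^sup>*" "(y, z) \<in> B\<^sup>*" "(z, w) \<in> A\<^sup>*" by blast
    show ?case
    proof (cases "(w, w') \<in> A \<or> z = w")
      case True
      then show ?thesis using step(2) yz
        by (metis (no_types, lifting) Un_iff rtrancl.rtrancl_refl rtrancl_into_rtrancl)
    next
      case False
      then have B: "(w, w') \<in> B" using step(2) by blast
      have "w \<in> Range A" using False yz(3) by (metis RangeI rtranclE)
      then have w: "w = u" using B assms(3,5) by (auto simp: Field_def)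
      have "y = z"
      proof (rule ccontr)
        assume "y \<noteq> z"
        then have "z \<in> Range B" using yz(2) by (metis RangeI rtranclE)
        moreover have "z \<in> Domain A" using False yz(3) by (metis DomainI converse_rtranclE)
        ultimately have "z = v" using assms(3,4) by (auto simp: Field_def)
        then show False using assms(6) yz(3) w by blast
      qed
      then have "(x, w) \<in> A\<^sup>*" using yz by simp
      then show ?thesis using B by blast
    qed
  qed blast
  show ?thesis
  proof (rule acyclicI, intro allI notI)
    fix x assume "(x, x) \<in> (A \<union> B)\<^sup>+"
    then obtain x' where x': "(x, x') \<in> A \<union> B" "(x', x) \<in> (A \<union> B)\<^sup>*"
      by (meson tranclD)
    then obtain y z where yz: "(x', y) \<in> A\<^sup>*" "(y, z) \<in> B\<^sup>*" "(z, x) \<in> A\<^sup>*"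
      using decomp by blast
    have nA: "(a, a) \<notin> A\<^sup>+" and nB: "(a, a) \<notin> B\<^sup>+" for a
      using assms(1,2) by (auto simp: acyclic_def)
    show False
    proof (cases "(x, x') \<in> A")
      case True
      then have zy: "(z, y) \<in> A\<^sup>+"
        using yz by (meson rtrancl_into_trancl2 rtrancl_trancl_trancl trancl_rtrancl_trancl)
      then have "y \<noteq> z" using nA by blast
      then have "z \<in> Range B" "y \<in> Domain B"
        using yz(2) by (metis RangeI rtranclE, metis DomainI converse_rtranclE)
      moreover have "z \<in> Domain A" "y \<in> Range A"
        using zy by (meson DomainI tranclD, meson RangeI tranclD2)
      ultimately have "z = v" "y = u" using assms(3-5) by (auto simp: Field_def)
      then show False using zy assms(6) by (meson trancl_into_rtrancl)
    next
      case False
      then have B: "(x, x') \<in> B" using x' by blast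
      show False
      proof (cases "x' = y")
        case True
        then have xz: "(x, z) \<in> B\<^sup>+" using B yz(2) by (meson rtrancl_into_trancl2)
        then have "x \<noteq> z" using nB by blast
        then have "z \<in> Domain A" "x \<in> Range A"
          using yz(3) by (metis DomainI converse_rtranclE, metis RangeI rtranclE)
        moreover have "z \<in> Range B" "x \<in> Domain B"
          using xz by (meson RangeI tranclD2, meson DomainI tranclD)
        ultimately have "z = v" "x = u" using assms(3-5) by (auto simp: Field_def)
        then show False using yz(3) assms(6) by blast
      next
        case False
        then have "x' \<in> Domain A" using yz(1) by (metis DomainI converse_rtranclE)
        then have x'v: "x' = v" using B assms(3,4) by (auto simp: Field_def)
        show False
        proof (cases "y = z")
          case True
          then have "(v, x) \<in> A\<^sup>*" using yz x'v by auto
          moreover have "x \<in> Domain B" using B by blast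
          moreover have "x \<noteq> v" using B assms(5) by blast
          ultimately have "x \<in> Range A" by (metis RangeI rtranclE)
          then have "x = u" using \<open>x \<in> Domain B\<close> \<open>x \<noteq> v\<close> assms(3) by (auto simp: Field_def)
          then show False using \<open>(v, x) \<in> A\<^sup>*\<close> assms(6) by blast
        next
          case False
          then have "y \<in> Domain B" using yz(2) by (metis DomainI converse_rtranclE)
          moreover have "y \<in> Range A" using yz(1) \<open>x' \<noteq> y\<close> by (metis RangeI rtranclE)
          ultimately have "y = u" using assms(3,5) by (auto simp: Field_def)
          then show False using yz(1) x'v assms(6) by blast
        qed
      qed
    qed
  qed
qed

lemma acyclic_antisym:
  assumes "acyclic E" "(u, v) \<in> E\<^sup>*" "(v, u) \<in> E\<^sup>*"
  shows "u = v"
  using assms by (meson acyclic_impl_antisym_rtrancl antisymD)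

section \<open>Series-parallel arc sets\<close>

text \<open>A series-parallel digraph has no isolated vertices, so \<open>Field\<close> recovers its
  vertices from its arcs. Working with bare arc sets turns subgraphs into subsets and gluing into
  union.\<close>

inductive sp :: "'a \<Rightarrow> 'a \<Rightarrow> 'a rel \<Rightarrow> bool" where
  sp_edge: "s \<noteq> t \<Longrightarrow> sp s t {(s, t)}"
| sp_parallel: "\<lbrakk>sp s t A; sp s t B; Field A \<inter> Field B = {s, t}; A \<inter> B = {}\<rbrakk> \<Longrightarrow> sp s t (A \<union> B)"
| sp_series: "\<lbrakk>sp s m A; sp m t B; Field A \<inter> Field B = {m}\<rbrakk> \<Longrightarrow> sp s t (A \<union> B)"

lemma dsp_iff_sp: "dsp s t G \<longleftrightarrow> sp s t (parcs G) \<and> pverts G = Field (parcs G)"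
proof
  show "sp s t (parcs G) \<and> pverts G = Field (parcs G)" if "dsp s t G"
    using that by (induction rule: dsp.induct) (auto simp: Field_Un intro: sp.intros)
  have "dsp s t \<lparr>pverts = Field A, parcs = A\<rparr>" if "sp s t A" for A
    using that
  proof (induction rule: sp.induct)
    case (sp_edge s t)
    then have "Field {(s, t)} = {s, t}" by (auto simp: Field_def)
    then show ?case using dsp.edge[OF sp_edge] by simp
  next
    case (sp_parallel s t A B)
    then show ?case using dsp.parallel[OF sp_parallel.IH] by (simp add: Field_Un)
  next
    case (sp_series s m A t B)
    then show ?case using dsp.series[OF sp_series.IH] by (simp add: Field_Un)
  qed
  then show "dsp s t G" if "sp s t (parcs G) \<and> pverts G = Field (parcs G)"
    using that by (metis old.unit.exhaust pair_pre_digraph.surjective)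
qed

lemma sp_terminals:
  assumes "sp s t E"
  shows "s \<noteq> t \<and> s \<in> Field E \<and> t \<in> Field E \<and> s \<notin> Range E \<and> t \<notin> Domain E"
  using assms
proof (induction rule: sp.induct)
  case (sp_series s m A t B)
  have A: "s \<noteq> m" "s \<in> Field A" "s \<notin> Range A" and B: "m \<noteq> t" "t \<in> Field B" "t \<notin> Domain B"
    using sp_series.IH by auto
  have "s \<notin> Field B" "t \<notin> Field A" using A B sp_series.hyps(3) by auto
  moreover from this have "s \<noteq> t" using A by metis
  ultimately show ?case using A B by (simp add: Field_def Domain_Un_eq Range_Un_eq)
qed (auto simp: Field_def)

lemma sp_reach:
  assumes "sp s t E" "v \<in> Field E"
  shows "(s, v) \<in> E\<^sup>*" "(v, t) \<in> E\<^sup>*"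
proof -
  have "\<forall>v\<in>Field E. (s, v) \<in> E\<^sup>* \<and> (v, t) \<in> E\<^sup>*"
    using assms(1)
  proof (induction rule: sp.induct)
    case (sp_edge s t)
    then show ?case by (auto simp: Field_def)
  next
    case (sp_parallel s t A B)
    then show ?case using rtrancl_mono[of A "A \<union> B"] rtrancl_mono[of B "A \<union> B"]
      by (auto simp: Field_Un)
  next
    case (sp_series s m A t B)
    note mono = subsetD[OF rtrancl_mono[of A "A \<union> B"]] subsetD[OF rtrancl_mono[of B "A \<union> B"]]
    have "(s, m) \<in> (A \<union> B)\<^sup>*" "(m, t) \<in> (A \<union> B)\<^sup>*"
      using sp_series mono by blast+
    then show ?case using sp_series mono
      by (metis Field_Un UnE Un_upper1 Un_upper2 rtrancl_trans)
  qed
  then show "(s, v) \<in> E\<^sup>*" "(v, t) \<in> E\<^sup>*" using assms(2) by auto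
qed

lemma sp_acyclic:
  assumes "sp s t E"
  shows "acyclic E"
  using assms
proof (induction rule: sp.induct)
  case (sp_edge s t)
  then show ?case by (auto simp: acyclic_def trancl_insert)
next
  case (sp_parallel s t A B)
  have "(t, s) \<notin> A\<^sup>*"
    using sp_terminals[OF sp_parallel.hyps(1)] rtrancl_outside_Field[of t s A] by metis
  then show ?case
    using acyclic_Un_disjoint[of A B s t] sp_parallel sp_terminals[OF sp_parallel.hyps(2)] by auto
next
  case (sp_series s m A t B)
  have "t \<notin> Domain A"
    using sp_series.hyps(3) sp_terminals[OF sp_series.hyps(2)] by (auto simp: Field_def)
  then have "(t, m) \<notin> A\<^sup>*"
    using sp_terminals[OF sp_series.hyps(2)] rtrancl_outside_Field[of t m A] by metis
  then show ?case
    using acyclic_Un_disjoint[of A B m t] sp_series sp_terminals[OF sp_series.hyps(2)] by auto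
qed

section \<open>Topological minors and \<open>W\<close>\<close>

text \<open>The set \<open>X (x, y)\<close> confines the path replacing the arc \<open>(x, y)\<close>, so that internal disjointness becomes
  disjointness of sets and no concrete paths have to be carried around.\<close>

definition topological_minor :: "'k pair_pre_digraph \<Rightarrow> 'a rel \<Rightarrow> bool" where
  "topological_minor K E \<longleftrightarrow> (\<exists>(f :: 'k \<Rightarrow> 'a) (X :: 'k \<times> 'k \<Rightarrow> 'a set).
     inj_on f (pverts K) \<and>
     (\<forall>(x, y) \<in> parcs K. (f x, f y) \<in> (Restr E (X (x, y)))\<^sup>* \<and>
        X (x, y) \<inter> f ` pverts K \<subseteq> {f x, f y}) \<and>
     (\<forall>e \<in> parcs K. \<forall>e' \<in> parcs K. e \<noteq> e' \<longrightarrow> X e \<inter> X e' \<subseteq> f ` pverts K))"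

lemma topological_minor_mono:
  fixes K :: "'k pair_pre_digraph" and E F :: "'a rel"
  assumes "topological_minor K E" "E \<subseteq> F"
  shows "topological_minor K F"
proof -
  have mono: "(Restr E X)\<^sup>* \<subseteq> (Restr F X)\<^sup>*" for X
    using assms(2) by (intro rtrancl_mono) blast
  obtain f :: "'k \<Rightarrow> 'a" and X where fX: "inj_on f (pverts K)"
    "\<forall>(x, y) \<in> parcs K. (f x, f y) \<in> (Restr E (X (x, y)))\<^sup>* \<and> X (x, y) \<inter> f ` pverts K \<subseteq> {f x, f y}"
    "\<forall>e \<in> parcs K. \<forall>e' \<in> parcs K. e \<noteq> e' \<longrightarrow> X e \<inter> X e' \<subseteq> f ` pverts K"
    using assms(1) unfolding topological_minor_def by blast
  have "\<forall>(x, y) \<in> parcs K. (f x, f y) \<in> (Restr F (X (x, y)))\<^sup>* \<and> X (x, y) \<inter> f ` pverts K \<subseteq> {f x, f y}"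
    using fX(2) mono by blast
  then show ?thesis using fX(1,3) unfolding topological_minor_def by blast
qed

text \<open>\<open>X1\<close> to \<open>X5\<close> confine the paths for \<open>ab\<close>,
  \<open>ac\<close>, \<open>bd\<close>, \<open>cd\<close> and \<open>bc\<close>, in this order. Each
  pairwise intersection is bounded by the common corner of the two arcs, if there is one.\<close>

lemma W_topological_minorI:
  assumes "distinct [a, b, c, d]"
    "(a, b) \<in> (Restr E X1)\<^sup>*" "c \<notin> X1" "d \<notin> X1"
    "(a, c) \<in> (Restr E X2)\<^sup>*" "b \<notin> X2" "d \<notin> X2"
    "(b, d) \<in> (Restr E X3)\<^sup>*" "a \<notin> X3" "c \<notin> X3"
    "(c, d) \<in> (Restr E X4)\<^sup>*" "a \<notin> X4" "b \<notin> X4"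
    "(b, c) \<in> (Restr E X5)\<^sup>*" "a \<notin> X5" "d \<notin> X5"
    "X1 \<inter> X2 \<subseteq> {a}" "X1 \<inter> X3 \<subseteq> {b}" "X1 \<inter> X4 \<subseteq> {}" "X1 \<inter> X5 \<subseteq> {b}" "X2 \<inter> X3 \<subseteq> {}"
    "X2 \<inter> X4 \<subseteq> {c}" "X2 \<inter> X5 \<subseteq> {c}" "X3 \<inter> X4 \<subseteq> {d}" "X3 \<inter> X5 \<subseteq> {b}" "X4 \<inter> X5 \<subseteq> {c}"
  shows "topological_minor W E"
proof -
  define f where "f = (\<lambda>v. case v of Wa \<Rightarrow> a | Wb \<Rightarrow> b | Wc \<Rightarrow> c | Wd \<Rightarrow> d)"
  define X where "X = (\<lambda>_. {})((Wa, Wb) := X1, (Wa, Wc) := X2, (Wb, Wd) := X3, (Wc, Wd) := X4, (Wb, Wc) := X5)"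
  have f: "f Wa = a" "f Wb = b" "f Wc = c" "f Wd = d" by (simp_all add: f_def)
  have X: "X (Wa, Wb) = X1" "X (Wa, Wc) = X2" "X (Wb, Wd) = X3" "X (Wc, Wd) = X4" "X (Wb, Wc) = X5"
    by (simp_all add: X_def)
  show ?thesis
    unfolding topological_minor_def
  proof (intro exI[of _ f] exI[of _ X] conjI)
    show "inj_on f (pverts W)" using assms(1) by (auto simp: W_def inj_on_def f)
    have img: "f ` pverts W = {a, b, c, d}" by (simp add: W_def f)
    show "\<forall>(x, y)\<in>parcs W. (f x, f y) \<in> (Restr E (X (x, y)))\<^sup>* \<and> X (x, y) \<inter> f ` pverts W \<subseteq> {f x, f y}"
      unfolding img using assms(2-16) by (simp add: W_def f X) blast
    show "\<forall>e\<in>parcs W. \<forall>e'\<in>parcs W. e \<noteq> e' \<longrightarrow> X e \<inter> X e' \<subseteq> f ` pverts W"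
    proof -
      have "X1 \<inter> X2 \<subseteq> {a, b, c, d}" "X1 \<inter> X3 \<subseteq> {a, b, c, d}" "X1 \<inter> X4 \<subseteq> {a, b, c, d}"
        "X1 \<inter> X5 \<subseteq> {a, b, c, d}" "X2 \<inter> X3 \<subseteq> {a, b, c, d}" "X2 \<inter> X4 \<subseteq> {a, b, c, d}"
        "X2 \<inter> X5 \<subseteq> {a, b, c, d}" "X3 \<inter> X4 \<subseteq> {a, b, c, d}" "X3 \<inter> X5 \<subseteq> {a, b, c, d}"
        "X4 \<inter> X5 \<subseteq> {a, b, c, d}"
        by (rule order_trans, rule assms, simp)+
      then show ?thesis unfolding img by (simp add: W_def X Int_commute)
    qed
  qed
qed

text \<open>Fix chains \<open>Y\<close> from \<open>s\<close> to \<open>u\<close> and \<open>Z\<close> from \<open>x\<close> to \<open>t\<close>. The corners of \<open>W\<close> are the last vertex \<open>a\<close> in \<open>Y\<close>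
  on the way from \<open>s\<close> to \<open>x\<close>, the last vertex \<open>b\<close> in \<open>Z\<close> on the way from \<open>x\<close> to \<open>u\<close>, the first vertex \<open>c\<close> in
  \<open>Y\<close> after it, and the first vertex \<open>d\<close> in \<open>Z\<close> on the way from \<open>u\<close> to \<open>t\<close>. Acyclicity keeps the pieces apart,
  since each of them lies in an interval of the reachability order.\<close>

lemma W_topological_minor_crossing:
  assumes acyc: "acyclic E" and disj: "A \<inter> B = {}" and mem: "s \<in> A" "u \<in> A" "x \<in> B" "t \<in> B"
    and su: "(s, u) \<in> (Restr E A)\<^sup>*" and xt: "(x, t) \<in> (Restr E B)\<^sup>*"
    and sx: "(s, x) \<in> E\<^sup>*" and xu: "(x, u) \<in> E\<^sup>*" and ut: "(u, t) \<in> E\<^sup>*"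
  shows "topological_minor W E"
proof -
  obtain Y where Y: "Y \<subseteq> A" "s \<in> Y" "u \<in> Y"
    "\<And>y. y \<in> Y \<Longrightarrow> (s, y) \<in> (Restr E Y)\<^sup>*" "\<And>y. y \<in> Y \<Longrightarrow> (y, u) \<in> (Restr E Y)\<^sup>*"
    "\<And>y z. y \<in> Y \<Longrightarrow> z \<in> Y \<Longrightarrow> (y, z) \<in> (Restr E Y)\<^sup>* \<or> (z, y) \<in> (Restr E Y)\<^sup>*"
    using rtrancl_chain[OF su mem(1)] by metis
  obtain Z where Z: "Z \<subseteq> B" "x \<in> Z" "t \<in> Z"
    "\<And>y. y \<in> Z \<Longrightarrow> (x, y) \<in> (Restr E Z)\<^sup>*" "\<And>y. y \<in> Z \<Longrightarrow> (y, t) \<in> (Restr E Z)\<^sup>*"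
    "\<And>y z. y \<in> Z \<Longrightarrow> z \<in> Z \<Longrightarrow> (y, z) \<in> (Restr E Z)\<^sup>* \<or> (z, y) \<in> (Restr E Z)\<^sup>*"
    using rtrancl_chain[OF xt mem(3)] by metis
  have YZ: "Y \<inter> Z = {}" using Y(1) Z(1) disj by blast
  note sub = rtrancl_subsetD[of _ _ _ E] and anti = acyclic_antisym[OF acyc] and tr = rtrancl_trans[of _ _ E]
  have RE: "(y, z) \<in> E\<^sup>*" if "(y, z) \<in> (Restr E V)\<^sup>*" for y z V
    using sub[OF that] by blast
  obtain a where a: "a \<in> Y" "(a, x) \<in> (E \<inter> UNIV \<times> - Y)\<^sup>*"
    using rtrancl_last_in[OF sx Y(2)] by metis
  obtain d where d: "d \<in> Z" "(u, d) \<in> (E \<inter> (- Z) \<times> UNIV)\<^sup>*"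
    using rtrancl_first_in[OF ut Z(3)] by metis
  obtain b where b: "b \<in> Z" "(x, b) \<in> E\<^sup>*" "(b, u) \<in> (E \<inter> UNIV \<times> - Z)\<^sup>*"
    using rtrancl_last_in[OF xu Z(2)] by metis
  \<comment> \<open>Heads avoid \<open>Z\<close> and tails avoid \<open>Y\<close>. On an
    \<open>F\<close>-path from \<open>b\<close> to \<open>c\<close>, only the start can lie in
    \<open>Z\<close> and only the end in \<open>Y\<close>.\<close>
  define F where "F = E \<inter> (- Y) \<times> (- Z)"
  obtain c where c: "c \<in> Y" "(b, c) \<in> F\<^sup>*" "(c, u) \<in> E\<^sup>*"
  proof -
    obtain c where "c \<in> Y" "(b, c) \<in> (E \<inter> UNIV \<times> - Z \<inter> (- Y) \<times> UNIV)\<^sup>*" "(c, u) \<in> (E \<inter> UNIV \<times> - Z)\<^sup>*"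
      using rtrancl_first_in[OF b(3) Y(3)] by metis
    moreover have "E \<inter> UNIV \<times> - Z \<inter> (- Y) \<times> UNIV = F" by (auto simp: F_def)
    ultimately show ?thesis using that[of c] sub[of c u "E \<inter> UNIV \<times> - Z"] by auto
  qed
  have ax: "(a, x) \<in> E\<^sup>*" using a(2) sub by blast
  have ud: "(u, d) \<in> E\<^sup>*" using d(2) sub by blast
  have bc: "(b, c) \<in> E\<^sup>*" using c(2) sub unfolding F_def by blast
  have ab: "(a, b) \<in> E\<^sup>*" "(c, d) \<in> E\<^sup>*" using ax b(2) c(3) ud tr by blast+
  have ac: "(a, c) \<in> E\<^sup>*" and bd: "(b, d) \<in> E\<^sup>*" using ab bc tr by blast+
  have ne: "a \<noteq> b" "b \<noteq> c" "c \<noteq> d" "a \<noteq> d" using a(1) b(1) c(1) d(1) YZ by auto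
  have ne': "a \<noteq> c" "b \<noteq> d" using ne ab bc anti by metis+
  \<comment> \<open>The chain property joins \<open>a\<close> and \<open>c\<close> inside
    \<open>Y\<close> in some direction; since \<open>a\<close> reaches \<open>c\<close> in the
    acyclic \<open>E\<close>, it is this one.\<close>
  have acY: "(a, c) \<in> (Restr E Y)\<^sup>*"
    using Y(6)[OF a(1) c(1)] RE[of c a Y] anti[OF ac] by auto
  have bdZ: "(b, d) \<in> (Restr E Z)\<^sup>*"
    using Z(6)[OF b(1) d(1)] RE[of d b Z] anti[OF bd] by auto
  define I where "I = (\<lambda>p q. {w. (p, w) \<in> E\<^sup>* \<and> (w, q) \<in> E\<^sup>*})"
  have IY: "(y, z) \<in> (Restr E (Y \<inter> I y z))\<^sup>*" if "(y, z) \<in> (Restr E Y)\<^sup>*" "y \<in> Y" for y z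
  proof (rule rtrancl_in_Restr_interval[OF that(1)])
    fix w assume w: "(y, w) \<in> (Restr E Y)\<^sup>*" "(w, z) \<in> (Restr E Y)\<^sup>*"
    then show "w \<in> Y \<inter> I y z" using that(2) RE unfolding I_def by (auto elim: rtranclE)
  qed blast
  have IZ: "(y, z) \<in> (Restr E (Z \<inter> I y z))\<^sup>*" if "(y, z) \<in> (Restr E Z)\<^sup>*" "y \<in> Z" for y z
  proof (rule rtrancl_in_Restr_interval[OF that(1)])
    fix w assume w: "(y, w) \<in> (Restr E Z)\<^sup>*" "(w, z) \<in> (Restr E Z)\<^sup>*"
    then show "w \<in> Z \<inter> I y z" using that(2) RE unfolding I_def by (auto elim: rtranclE)
  qed blast
  \<comment> \<open>The path for \<open>ab\<close> runs through \<open>x\<close>: outside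
    \<open>Y\<close> up to \<open>x\<close>, then along \<open>Z\<close>. Dually, the path for
    \<open>cd\<close> runs along \<open>Y\<close> up to \<open>u\<close>, then outside
    \<open>Z\<close>. The paths for \<open>ac\<close> and \<open>bd\<close> stay on the chains
    \<open>Y\<close> and \<open>Z\<close>.\<close>
  define X1 where "X1 = I a x \<inter> insert a (- Y) \<union> Z \<inter> I x b"
  define X2 where "X2 = Y \<inter> I a c"
  define X3 where "X3 = Z \<inter> I b d"
  define X4 where "X4 = Y \<inter> I c u \<union> I u d \<inter> insert d (- Z)"
  define X5 where "X5 = I b c \<inter> insert b (- Z) \<inter> insert c (- Y)"
  have X1: "(a, b) \<in> (Restr E X1)\<^sup>*"
  proof -
    have "(a, x) \<in> (Restr E (I a x \<inter> insert a (- Y)))\<^sup>*"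
    proof (rule rtrancl_in_Restr_interval[OF a(2)])
      fix w assume w: "(a, w) \<in> (E \<inter> UNIV \<times> - Y)\<^sup>*" "(w, x) \<in> (E \<inter> UNIV \<times> - Y)\<^sup>*"
      have "(a, w) \<in> E\<^sup>*" "(w, x) \<in> E\<^sup>*" using w sub by blast+
      moreover have "w \<in> insert a (- Y)" using w(1) by (auto elim: rtranclE)
      ultimately show "w \<in> I a x \<inter> insert a (- Y)" unfolding I_def by blast
    qed blast
    then have "(a, x) \<in> (Restr E X1)\<^sup>*" by (rule rtrancl_Restr_mono) (auto simp: X1_def)
    moreover have "(x, b) \<in> (Restr E X1)\<^sup>*"
      using IZ[OF Z(4)[OF b(1)] Z(2)] by (rule rtrancl_Restr_mono) (auto simp: X1_def)
    ultimately show ?thesis by (rule rtrancl_trans)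
  qed
  have X2: "(a, c) \<in> (Restr E X2)\<^sup>*" unfolding X2_def using IY[OF acY a(1)] .
  have X3: "(b, d) \<in> (Restr E X3)\<^sup>*" unfolding X3_def using IZ[OF bdZ b(1)] .
  have X4: "(c, d) \<in> (Restr E X4)\<^sup>*"
  proof -
    have "(u, d) \<in> (Restr E (I u d \<inter> insert d (- Z)))\<^sup>*"
    proof (rule rtrancl_in_Restr_interval[OF d(2)])
      fix w assume w: "(u, w) \<in> (E \<inter> (- Z) \<times> UNIV)\<^sup>*" "(w, d) \<in> (E \<inter> (- Z) \<times> UNIV)\<^sup>*"
      have "(u, w) \<in> E\<^sup>*" "(w, d) \<in> E\<^sup>*" using w sub by blast+
      moreover have "w \<in> insert d (- Z)" using w(2) by (auto elim: converse_rtranclE)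
      ultimately show "w \<in> I u d \<inter> insert d (- Z)" unfolding I_def by blast
    qed blast
    then have "(u, d) \<in> (Restr E X4)\<^sup>*" by (rule rtrancl_Restr_mono) (auto simp: X4_def)
    moreover have "(c, u) \<in> (Restr E X4)\<^sup>*"
      using IY[OF Y(5)[OF c(1)] c(1)] by (rule rtrancl_Restr_mono) (auto simp: X4_def)
    ultimately show ?thesis by (meson rtrancl_trans)
  qed
  have X5: "(b, c) \<in> (Restr E X5)\<^sup>*"
  proof (rule rtrancl_in_Restr_interval[OF c(2)])
    fix w assume w: "(b, w) \<in> F\<^sup>*" "(w, c) \<in> F\<^sup>*"
    have "(b, w) \<in> E\<^sup>*" "(w, c) \<in> E\<^sup>*" using w sub unfolding F_def by blast+
    moreover have "w \<in> insert b (- Z)" using w(1) unfolding F_def by (auto elim: rtranclE)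
    moreover have "w \<in> insert c (- Y)" using w(2) unfolding F_def by (auto elim: converse_rtranclE)
    ultimately show "w \<in> X5" unfolding I_def X5_def by blast
  qed (auto simp: F_def)
  \<comment> \<open>In the reachability order, \<open>X1\<close> lies before \<open>b\<close>,
    \<open>X2\<close> before \<open>c\<close>, \<open>X3\<close> after \<open>b\<close>,
    \<open>X4\<close> after \<open>c\<close>, and \<open>X5\<close> between \<open>b\<close> and
    \<open>c\<close>. Pairs not separated by these bounds are separated by the disjointness of
    \<open>Y\<close> and \<open>Z\<close>.\<close>
  have le1: "(w, b) \<in> E\<^sup>*" if "w \<in> X1" for w
    using that b(2) tr unfolding X1_def I_def by blast
  have le2: "(w, c) \<in> E\<^sup>*" "w \<in> Y" if "w \<in> X2" for w
    using that unfolding X2_def I_def by blast+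
  have le3: "(b, w) \<in> E\<^sup>*" "w \<in> Z" if "w \<in> X3" for w
    using that unfolding X3_def I_def by blast+
  have le4: "(c, w) \<in> E\<^sup>*" if "w \<in> X4" for w
    using that c(3) tr unfolding X4_def I_def by blast
  have le5: "(b, w) \<in> E\<^sup>*" "(w, c) \<in> E\<^sup>*" "w \<in> Z \<Longrightarrow> w = b" "w \<in> Y \<Longrightarrow> w = c" if "w \<in> X5" for w
    using that unfolding X5_def I_def by blast+
  have Z1: "w = a" if "w \<in> X1" "w \<in> Y" for w using that YZ unfolding X1_def by blast
  have Z4: "w = d" if "w \<in> X4" "w \<in> Z" for w using that YZ unfolding X4_def by blast
  have nab: "b \<notin> Y" "d \<notin> Y" "a \<notin> Z" "c \<notin> Z" using a(1) b(1) c(1) d(1) YZ by auto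
  have nba: "(b, a) \<notin> E\<^sup>*" "(c, b) \<notin> E\<^sup>*" "(d, c) \<notin> E\<^sup>*" "(d, b) \<notin> E\<^sup>*" "(c, a) \<notin> E\<^sup>*"
    using ne ne' ab bc bd ac anti by metis+
  show ?thesis
  proof (rule W_topological_minorI[of a b c d E X1 X2 X3 X4 X5])
    show "distinct [a, b, c, d]" using ne ne' by auto
    show "X1 \<inter> X2 \<subseteq> {a}" using Z1 le2 by blast
    show "X1 \<inter> X3 \<subseteq> {b}" using le1 le3 anti by blast
    show "X1 \<inter> X4 \<subseteq> {}" using le1 le4 tr nba(2) by blast
    show "X1 \<inter> X5 \<subseteq> {b}" using le1 le5(1) anti by blast
    show "X2 \<inter> X3 \<subseteq> {}" using le2(2) le3(2) YZ by blast
    show "X2 \<inter> X4 \<subseteq> {c}" using le2(1) le4 anti by blast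
    show "X2 \<inter> X5 \<subseteq> {c}" using le2(2) le5(4) by blast
    show "X3 \<inter> X4 \<subseteq> {d}" using le3(2) Z4 by blast
    show "X3 \<inter> X5 \<subseteq> {b}" using le3(2) le5(3) by blast
    show "X4 \<inter> X5 \<subseteq> {c}" using le4 le5(2) anti by blast
    show "c \<notin> X1" "d \<notin> X1" using le1 nba by blast+
    show "b \<notin> X2" "d \<notin> X2" using le2(2) nab by blast+
    show "a \<notin> X3" "c \<notin> X3" using le3(2) nab by blast+
    show "a \<notin> X4" "b \<notin> X4" using le4 nba by blast+
    show "a \<notin> X5" "d \<notin> X5" using le5(1,2) nba by blast+
  qed (fact X1 X2 X3 X4 X5)+
qed

section \<open>Paths through parallel and series compositions\<close>

text \<open>The two sides meet only in \<open>s\<close>, which no arc enters, and \<open>t\<close>,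
  which no arc leaves. Traced back from \<open>v\<close>, the walk therefore never changes sides.
  The companion \<open>parallel_rtrancl_from_inner\<close> traces forwards.\<close>

lemma parallel_rtrancl_to_inner:
  assumes "sp s t A" "sp s t B" "Field A \<inter> Field B = {s, t}" "v \<in> Field A" "v \<noteq> t"
    and "(x, v) \<in> (Restr (A \<union> B) X)\<^sup>*"
  shows "(x, v) \<in> (Restr A X)\<^sup>*"
  using assms(6)
proof (induction rule: converse_rtrancl_induct)
  case (step y z)
  note A = sp_terminals[OF assms(1)] and B = sp_terminals[OF assms(2)]
  have "z = v \<or> z \<in> Domain A" using step.IH by (metis DomainI IntE converse_rtranclE)
  then have z: "z \<in> Field A" "z \<noteq> t" using assms(4,5) A by (auto simp: Field_def)
  have "(y, z) \<notin> B"
  proof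
    assume "(y, z) \<in> B"
    then have "z \<in> Field B" "z \<noteq> s" using B by (auto simp: Field_def)
    then show False using assms(3) z by blast
  qed
  then show ?case using step by (meson IntE IntI UnE converse_rtrancl_into_rtrancl)
qed simp

lemma parallel_rtrancl_from_inner:
  assumes "sp s t A" "sp s t B" "Field A \<inter> Field B = {s, t}" "v \<in> Field A" "v \<noteq> s"
    and "(v, x) \<in> (Restr (A \<union> B) X)\<^sup>*"
  shows "(v, x) \<in> (Restr A X)\<^sup>*"
  using assms(6)
proof (induction rule: rtrancl_induct)
  case (step y z)
  note A = sp_terminals[OF assms(1)] and B = sp_terminals[OF assms(2)]
  have "y = v \<or> y \<in> Range A" using step.IH by (metis RangeI IntE rtranclE)
  then have y: "y \<in> Field A" "y \<noteq> s" using assms(4,5) A by (auto simp: Field_def)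
  have "(y, z) \<notin> B"
  proof
    assume "(y, z) \<in> B"
    then have "y \<in> Field B" "y \<noteq> t" using B by (auto simp: Field_def)
    then show False using assms(3) y by blast
  qed
  then show ?case using step by (meson IntE IntI UnE rtrancl_into_rtrancl)
qed simp

text \<open>An arc leaving a vertex of \<open>A\<close> other than \<open>m\<close> belongs to
  \<open>A\<close>, so a walk that avoids \<open>m\<close> is trapped in \<open>A\<close> without
  \<open>m\<close>, where no vertex of \<open>B\<close> lies.\<close>

lemma series_rtrancl_cut:
  assumes "Field A \<inter> Field B = {m}" "u \<in> Field A" "v \<in> Field B" "u \<noteq> m"
    and "(u, v) \<in> (Restr (A \<union> B) X)\<^sup>*"
  shows "m \<in> X"
proof (rule ccontr)
  assume m: "m \<notin> X"
  have "v \<in> Field A - {m}"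
    using assms(5)
  proof (induction rule: rtrancl_induct)
    case (step y z)
    then have "(y, z) \<in> A" using assms(1) by (auto simp: Field_def)
    then show ?case using step(2) m by (auto simp: Field_def)
  qed (use assms in blast)
  then show False using assms(1,3) by blast
qed

text \<open>The configuration excluded here is a \<open>W\<close> whose corners \<open>a\<close> and \<open>d\<close> are the terminals;
  it lies inside one side of a parallel composition, and a series composition would put the
  cut vertex on two internally disjoint paths.\<close>

lemma sp_no_crossing:
  assumes "sp s t E" "X \<inter> Y \<subseteq> {s, t}" "b \<notin> {s, t}" "c \<notin> {s, t}"
    "(s, b) \<in> (Restr E X)\<^sup>*" "(b, t) \<in> (Restr E X)\<^sup>*"
    "(s, c) \<in> (Restr E Y)\<^sup>*" "(c, t) \<in> (Restr E Y)\<^sup>*"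
    "(b, c) \<in> (Restr E (- {s, t}))\<^sup>*"
  shows False
  using assms
proof (induction rule: sp.induct)
  case (sp_edge s t)
  have "s \<noteq> b" using sp_edge.prems(2) by auto
  then have "b \<in> Field (Restr {(s, t)} X)" using rtrancl_Field[OF sp_edge.prems(4)] by simp
  then have "b \<in> {s, t}" by (auto simp: Field_def)
  then show False using sp_edge.prems(2) by simp
next
  case (sp_parallel s t A B)
  \<comment> \<open>Stated for \<open>A'\<close> and \<open>B'\<close> so that it serves both sides.
    If \<open>b\<close> is in \<open>A'\<close>, then so is \<open>c\<close>, because the path from
    \<open>b\<close> to \<open>c\<close> avoids the terminals; all five paths then lie in
    \<open>A'\<close>, and the induction hypothesis applies.\<close>
  have side: "b \<notin> Field A'" if "sp s t A'" "sp s t B'" "Field A' \<inter> Field B' = {s, t}" "A' \<union> B' = A \<union> B"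
    and IH: "\<lbrakk>(s, b) \<in> (Restr A' X)\<^sup>*; (b, t) \<in> (Restr A' X)\<^sup>*; (s, c) \<in> (Restr A' Y)\<^sup>*;
      (c, t) \<in> (Restr A' Y)\<^sup>*; (b, c) \<in> (Restr A' (- {s, t}))\<^sup>*\<rbrakk> \<Longrightarrow> False" for A' B'
  proof
    assume b: "b \<in> Field A'"
    note to = parallel_rtrancl_to_inner[OF that(1-3)] and "from" = parallel_rtrancl_from_inner[OF that(1-3)]
    have ne: "b \<noteq> s" "b \<noteq> t" "c \<noteq> s" "c \<noteq> t" using sp_parallel.prems by auto
    have bc: "(b, c) \<in> (Restr A' (- {s, t}))\<^sup>*"
      using "from"[OF b ne(1)] sp_parallel.prems(8) unfolding that(4) .
    then have "c = b \<or> c \<in> Field (Restr A' (- {s, t}))" using rtrancl_Field by metis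
    then have c: "c \<in> Field A'" using b by (auto simp: Field_def)
    show False
    proof (rule IH)
      show "(s, b) \<in> (Restr A' X)\<^sup>*" "(s, c) \<in> (Restr A' Y)\<^sup>*"
        using to[OF b ne(2), of s X] to[OF c ne(4), of s Y] sp_parallel.prems unfolding that(4) by auto
      show "(b, t) \<in> (Restr A' X)\<^sup>*" "(c, t) \<in> (Restr A' Y)\<^sup>*"
        using "from"[OF b ne(1), of t X] "from"[OF c ne(3), of t Y] sp_parallel.prems
          unfolding that(4) by auto
    qed (fact bc)
  qed
  have "s \<noteq> b" using sp_parallel.prems(2) by auto
  then have "b \<in> Field (Restr (A \<union> B) X)" using rtrancl_Field[OF sp_parallel.prems(4)] by simp
  then have "b \<in> Field A \<or> b \<in> Field B" by (auto simp: Field_def)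
  moreover have "b \<notin> Field A"
    using side[of A B] sp_parallel.hyps sp_parallel.IH(1)[OF sp_parallel.prems(1-3)] by metis
  moreover have "b \<notin> Field B"
    using side[of B A] sp_parallel.hyps sp_parallel.IH(2)[OF sp_parallel.prems(1-3)]
    by (metis Int_commute Un_commute)
  ultimately show False by blast
next
  case (sp_series s m A t B)
  note A = sp_terminals[OF sp_series.hyps(1)] and B = sp_terminals[OF sp_series.hyps(2)]
  note cut = series_rtrancl_cut[OF sp_series.hyps(3), of s t]
  have "(s, t) \<in> (Restr (A \<union> B) X)\<^sup>*" "(s, t) \<in> (Restr (A \<union> B) Y)\<^sup>*"
    using sp_series.prems by (meson rtrancl_trans)+
  then have "m \<in> X \<inter> Y" using cut A B by blast
  then show False using sp_series.prems(1) A B by blast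
qed

section \<open>Adding an ear to a series-parallel digraph\<close>

text \<open>In a parallel composition \<open>u\<close> is inner to at most one side, and the other
  side supplies a path around it. In a series composition either \<open>u\<close> is the joint, or
  the alternative for the factor containing \<open>u\<close> carries over: a split is reassociated,
  a detour is extended through the other factor.\<close>

lemma sp_split_or_avoid:
  assumes "sp s t E" "u \<in> Field E" "u \<noteq> s" "u \<noteq> t"
  shows "(\<exists>A B. E = A \<union> B \<and> sp s u A \<and> sp u t B \<and> Field A \<inter> Field B = {u}) \<or>
    (s, t) \<in> (Restr E (- {u}))\<^sup>*"
  using assms
proof (induction rule: sp.induct)
  case (sp_edge s t)
  then show ?case by (auto simp: Field_def)
next
  case (sp_parallel s t A B)
  have "(s, t) \<in> (Restr (A \<union> B) (- {u}))\<^sup>*" if "sp s t C" "C \<subseteq> A \<union> B" "u \<notin> Field C" for C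
  proof -
    have "(s, t) \<in> C\<^sup>*" using sp_reach(2)[OF that(1)] sp_terminals[OF that(1)] by blast
    moreover have "C \<subseteq> Restr (A \<union> B) (- {u})" using that by (auto simp: Field_def)
    ultimately show ?thesis by (rule rtrancl_subsetD)
  qed
  moreover have "u \<notin> Field A \<or> u \<notin> Field B" using sp_parallel.hyps(3) sp_parallel.prems(2,3) by auto
  ultimately show ?case using sp_parallel.hyps(1,2) by auto
next
  case (sp_series s m A t B)
  note A = sp_terminals[OF sp_series.hyps(1)] and B = sp_terminals[OF sp_series.hyps(2)]
  have AB: "(s, m) \<in> A\<^sup>*" "(m, t) \<in> B\<^sup>*"
    using sp_reach sp_series.hyps A B by metis+
  consider "u = m" | "u \<in> Field A" "u \<noteq> m" | "u \<in> Field B" "u \<noteq> m"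
    using sp_series.prems by (auto simp: Field_Un)
  then show ?case
  proof cases
    case 1
    then show ?thesis using sp_series.hyps by blast
  next
    case 2
    then have uB: "u \<notin> Field B" using sp_series.hyps(3) by blast
    consider A1 A2 where "A = A1 \<union> A2" "sp s u A1" "sp u m A2" "Field A1 \<inter> Field A2 = {u}"
      | "(s, m) \<in> (Restr A (- {u}))\<^sup>*"
      using sp_series.IH(1) 2 sp_series.prems by blast
    then show ?thesis
    proof cases
      case 1
      have "m \<in> Field A2" using sp_terminals[OF 1(3)] by blast
      then have "sp u t (A2 \<union> B)"
        using 1 sp_series.hyps by (intro sp.sp_series[of u m A2 t B]) (auto simp: Field_Un)
      moreover have "Field A1 \<inter> Field (A2 \<union> B) = {u}"
        using 1 uB \<open>m \<in> Field A2\<close> \<open>u \<noteq> m\<close> sp_series.hyps(3) by (auto simp: Field_Un)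
      ultimately show ?thesis using 1 by blast
    next
      case 2
      have "(m, t) \<in> (Restr (A \<union> B) (- {u}))\<^sup>*"
        using AB(2) by (rule rtrancl_subsetD) (use uB in \<open>auto simp: Field_def\<close>)
      moreover have "(s, m) \<in> (Restr (A \<union> B) (- {u}))\<^sup>*"
        using 2 by (rule rtrancl_subsetD) auto
      ultimately show ?thesis by (meson rtrancl_trans)
    qed
  next
    case 3
    then have uA: "u \<notin> Field A" using sp_series.hyps(3) by blast
    consider B1 B2 where "B = B1 \<union> B2" "sp m u B1" "sp u t B2" "Field B1 \<inter> Field B2 = {u}"
      | "(m, t) \<in> (Restr B (- {u}))\<^sup>*"
      using sp_series.IH(2) 3 sp_series.prems by blast
    then show ?thesis
    proof cases
      case 1
      have "m \<in> Field B1" using sp_terminals[OF 1(2)] by blast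
      then have "sp s u (A \<union> B1)"
        using 1 sp_series.hyps by (intro sp.sp_series[of s m A u B1]) (auto simp: Field_Un)
      moreover have "Field (A \<union> B1) \<inter> Field B2 = {u}"
        using 1 uA \<open>m \<in> Field B1\<close> \<open>u \<noteq> m\<close> sp_series.hyps(3) by (auto simp: Field_Un)
      ultimately show ?thesis using 1 by (metis Un_assoc)
    next
      case 2
      have "(s, m) \<in> (Restr (A \<union> B) (- {u}))\<^sup>*"
        using AB(1) by (rule rtrancl_subsetD) (use uA in \<open>auto simp: Field_def\<close>)
      moreover have "(m, t) \<in> (Restr (A \<union> B) (- {u}))\<^sup>*"
        using 2 by (rule rtrancl_subsetD) auto
      ultimately show ?thesis by (meson rtrancl_trans)
    qed
  qed
qed

lemma acyclic_sp_ear: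
  assumes "acyclic M" "sp u v L" "Field M \<inter> Field L \<subseteq> {u, v}" "(v, u) \<notin> M\<^sup>*"
  shows "acyclic (M \<union> L)"
  using acyclic_Un_disjoint[OF assms(1) sp_acyclic[OF assms(2)] assms(3) _ _ assms(4)]
    sp_terminals[OF assms(2)] by blast

lemma sp_rtrancl_Restr_Field: "sp u v L \<Longrightarrow> L \<subseteq> E \<Longrightarrow> (u, v) \<in> (Restr E (Field L))\<^sup>*"
proof (rule rtrancl_subsetD[of _ _ L])
  assume "sp u v L" "L \<subseteq> E"
  then show "(u, v) \<in> L\<^sup>*" using sp_reach(2) sp_terminals by metis
  show "L \<subseteq> Restr E (Field L)" using \<open>L \<subseteq> E\<close> by (auto simp: Field_def)
qed

text \<open>The ear joins inner vertices of different sides. The path from \<open>s\<close> to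
  \<open>v\<close> in \<open>B\<close> and the path from \<open>u\<close> to \<open>t\<close> in
  \<open>A\<close> are disjoint, and the ear leads from the second to the first. In the crossing
  lemma, the ear's \<open>u\<close> thus plays \<open>x\<close> and its \<open>v\<close> plays
  \<open>u\<close>.\<close>

lemma parallel_ear_W:
  assumes A: "sp s t A" and B: "sp s t B" and AB: "Field A \<inter> Field B = {s, t}"
    and L: "sp u v L" "Field (A \<union> B) \<inter> Field L = {u, v}" "(v, u) \<notin> (A \<union> B)\<^sup>*"
    and u: "u \<in> Field A" "u \<notin> Field B" and v: "v \<in> Field B" "v \<notin> Field A"
    and acyc: "acyclic (A \<union> B)"
  shows "topological_minor W (A \<union> B \<union> L)"
proof (rule W_topological_minor_crossing[where A = "Field B - {t}" and B = "Field A - {s}" and s = s and t = t and x = u and u = v])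
  note TA = sp_terminals[OF A] and TB = sp_terminals[OF B]
  show "acyclic (A \<union> B \<union> L)" using acyclic_sp_ear[OF acyc L(1) _ L(3)] L(2) by blast
  show "(Field B - {t}) \<inter> (Field A - {s}) = {}" using AB by blast
  show "s \<in> Field B - {t}" "t \<in> Field A - {s}" using TA TB by auto
  show "v \<in> Field B - {t}" "u \<in> Field A - {s}" using u v TA TB by auto
  show "(s, v) \<in> (Restr (A \<union> B \<union> L) (Field B - {t}))\<^sup>*"
  proof (rule rtrancl_in_Restr_interval[OF sp_reach(1)[OF B v(1)]])
    fix w assume w: "(s, w) \<in> B\<^sup>*" "(w, v) \<in> B\<^sup>*"
    then show "w \<in> Field B - {t}"
      using rtrancl_Field[OF w(1)] rtrancl_outside_Field[OF w(2)] TA TB v by auto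
  qed blast
  show "(u, t) \<in> (Restr (A \<union> B \<union> L) (Field A - {s}))\<^sup>*"
  proof (rule rtrancl_in_Restr_interval[OF sp_reach(2)[OF A u(1)]])
    fix w assume w: "(u, w) \<in> A\<^sup>*" "(w, t) \<in> A\<^sup>*"
    then show "w \<in> Field A - {s}"
      using rtrancl_Field[OF w(2)] rtrancl_outside_Field[OF w(1)] TA TB u by auto
  qed blast
  show "(s, u) \<in> (A \<union> B \<union> L)\<^sup>*" using sp_reach(1)[OF A u(1)] by (rule rtrancl_subsetD) blast
  show "(v, t) \<in> (A \<union> B \<union> L)\<^sup>*" using sp_reach(2)[OF B v(1)] by (rule rtrancl_subsetD) blast
  have "(u, v) \<in> L\<^sup>*" using sp_reach(2)[OF L(1)] sp_terminals[OF L(1)] by blast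
  then show "(u, v) \<in> (A \<union> B \<union> L)\<^sup>*" by (rule rtrancl_subsetD) blast
qed

text \<open>The ear jumps over the joint \<open>m\<close>. If \<open>u\<close> splits
  \<open>A\<close> or equals \<open>s\<close>, and \<open>v\<close> splits \<open>B\<close> or
  equals \<open>t\<close>, the ear is parallel to the middle piece from \<open>u\<close> to
  \<open>v\<close>. Otherwise a path around \<open>u\<close> or \<open>v\<close> crosses the ear and
  gives a \<open>W\<close>.\<close>

lemma series_ear:
  assumes A: "sp s m A" and B: "sp m t B" and AB: "Field A \<inter> Field B = {m}"
    and L: "sp u v L" "Field (A \<union> B) \<inter> Field L = {u, v}" "(A \<union> B) \<inter> L = {}" "(v, u) \<notin> (A \<union> B)\<^sup>*"
    and u: "u \<in> Field A" "u \<noteq> m" and v: "v \<in> Field B" "v \<noteq> m"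
    and acyc: "acyclic (A \<union> B)"
  shows "sp s t (A \<union> B \<union> L) \<or> topological_minor W (A \<union> B \<union> L)"
proof (cases "(s, m) \<in> (Restr A (- {u}))\<^sup>* \<and> u \<noteq> s \<or> (m, t) \<in> (Restr B (- {v}))\<^sup>* \<and> v \<noteq> t")
  case True
  note TA = sp_terminals[OF A] and TB = sp_terminals[OF B] and TL = sp_terminals[OF L(1)]
  have acyc': "acyclic (A \<union> B \<union> L)" using acyclic_sp_ear[OF acyc L(1) _ L(4)] L(2) by blast
  have uB: "u \<notin> Field B" and vA: "v \<notin> Field A" using AB u v by blast+
  have um: "(u, m) \<in> (A \<union> B \<union> L)\<^sup>*" and su: "(s, u) \<in> (A \<union> B \<union> L)\<^sup>*"
    using sp_reach[OF A u(1)] by (auto elim: rtrancl_subsetD)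
  have mv: "(m, v) \<in> (A \<union> B \<union> L)\<^sup>*" and vt: "(v, t) \<in> (A \<union> B \<union> L)\<^sup>*"
    using sp_reach[OF B v(1)] by (auto elim: rtrancl_subsetD)
  have uv: "(u, v) \<in> (Restr (A \<union> B \<union> L) (Field L))\<^sup>*"
    using L(1) by (rule sp_rtrancl_Restr_Field) blast
  have "topological_minor W (A \<union> B \<union> L)"
  proof (cases "(s, m) \<in> (Restr A (- {u}))\<^sup>* \<and> u \<noteq> s")
    case True
    \<comment> \<open>The crossing is between the detour from \<open>s\<close> to \<open>m\<close>
      around \<open>u\<close> and the ear from \<open>u\<close> to \<open>v\<close>, with source
      \<open>s\<close> and sink \<open>v\<close>.\<close>
    then have "(s, m) \<in> (Restr (A \<union> B \<union> L) (Field A - {u}))\<^sup>*"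
      by (auto elim!: rtrancl_subsetD simp: Field_def)
    then show ?thesis
      using W_topological_minor_crossing[OF acyc' _ _ _ _ _ _ uv su um mv, of "Field A - {u}"]
        True TA TL u vA L(2) by (auto simp: Field_Un)
  next
    case False
    \<comment> \<open>Here the ear is the first path and the detour from \<open>m\<close> to
      \<open>t\<close> around \<open>v\<close> the second, with source \<open>u\<close> and sink
      \<open>t\<close>.\<close>
    then have "(m, t) \<in> (Restr B (- {v}))\<^sup>*" "v \<noteq> t" using True by blast+
    then have "(m, t) \<in> (Restr (A \<union> B \<union> L) (Field B - {v}))\<^sup>*"
      by (auto elim!: rtrancl_subsetD simp: Field_def)
    moreover have "Field L \<inter> (Field B - {v}) = {}" using L(2) uB by (auto simp: Field_Un)
    ultimately show ?thesis
      using W_topological_minor_crossing[OF acyc' _ _ _ _ _ uv _ um mv vt, of "Field B - {v}"]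
        \<open>v \<noteq> t\<close> TB TL v by simp
  qed
  then show ?thesis ..
next
  case False
  note TA = sp_terminals[OF A] and TB = sp_terminals[OF B] and TL = sp_terminals[OF L(1)]
  have uB: "u \<notin> Field B" and vA: "v \<notin> Field A" using AB u v by blast+
  \<comment> \<open>An ear starting at the terminal \<open>s\<close> leaves no initial piece. The
    empty set is not series-parallel, so this case is kept as a separate disjunct; the same holds
    for \<open>B2\<close> when \<open>v\<close> is \<open>t\<close>.\<close>
  obtain A1 A2 where A12: "A = A1 \<union> A2" "sp s u A1 \<or> A1 = {} \<and> s = u" "sp u m A2" "Field A1 \<inter> Field A2 \<subseteq> {u}"
  proof (cases "u = s")
    case True
    then show ?thesis using that[of "{}" A] A by simp
  next
    case False
    then show ?thesis
      using that sp_split_or_avoid[OF A u(1) False u(2)] \<open>\<not> (_ \<or> _)\<close> by (metis order_refl)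
  qed
  obtain B1 B2 where B12: "B = B1 \<union> B2" "sp m v B1" "sp v t B2 \<or> B2 = {} \<and> v = t" "Field B1 \<inter> Field B2 \<subseteq> {v}"
  proof (cases "v = t")
    case True
    then show ?thesis using that[of B "{}"] B by simp
  next
    case False
    then show ?thesis
      using that sp_split_or_avoid[OF B v(1,2) False] \<open>\<not> (_ \<or> _)\<close> by (metis order_refl)
  qed
  have F: "Field A = Field A1 \<union> Field A2" "Field B = Field B1 \<union> Field B2" "Field (A \<union> B) = Field A \<union> Field B"
    using A12(1) B12(1) by (simp_all add: Field_Un)
  have mem: "m \<in> Field A2" "u \<in> Field A2" "m \<in> Field B1" "v \<in> Field B1"
    using sp_terminals A12(3) B12(2) by metis+
  have AB': "\<And>w. w \<in> Field A1 \<or> w \<in> Field A2 \<Longrightarrow> w \<in> Field B1 \<or> w \<in> Field B2 \<Longrightarrow> w = m"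
    using AB unfolding F(1,2) by blast
  have L': "\<And>w. w \<in> Field A1 \<or> w \<in> Field A2 \<Longrightarrow> w \<in> Field L \<Longrightarrow> w = u"
    "\<And>w. w \<in> Field B1 \<or> w \<in> Field B2 \<Longrightarrow> w \<in> Field L \<Longrightarrow> w = v"
  proof -
    fix w assume "w \<in> Field L"
    then have uv: "w \<in> Field A \<or> w \<in> Field B \<Longrightarrow> w \<in> {u, v}" using L(2) F(3) by auto
    show "w = u" if "w \<in> Field A1 \<or> w \<in> Field A2" using that uv vA F(1) by auto
    show "w = v" if "w \<in> Field B1 \<or> w \<in> Field B2" using that uv uB F(2) by auto
  qed
  have nm: "m \<notin> Field B2" "m \<notin> Field A1" using A12(4) B12(4) mem u(2) v(2) by auto
  have "Field A2 \<inter> Field B1 = {m}" using AB' mem by blast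
  then have A2B1: "sp u v (A2 \<union> B1)" by (rule sp.sp_series[OF A12(3) B12(2)])
  have P: "sp u v (A2 \<union> B1 \<union> L)"
  proof (rule sp.sp_parallel[OF A2B1 L(1)])
    show "Field (A2 \<union> B1) \<inter> Field L = {u, v}"
      unfolding Field_Un using L' mem TL by blast
    show "(A2 \<union> B1) \<inter> L = {}" using L(3) A12(1) B12(1) by auto
  qed
  have Q: "sp u t (A2 \<union> B1 \<union> L \<union> B2)"
  proof (cases "B2 = {} \<and> v = t")
    case False
    then have B2: "sp v t B2" using B12(3) by metis
    then have "v \<in> Field B2" using sp_terminals by metis
    then have "Field (A2 \<union> B1 \<union> L) \<inter> Field B2 = {v}"
      unfolding Field_Un using AB' L'(2) nm(1) B12(4) mem(4) by blast
    then show ?thesis by (rule sp.sp_series[OF P B2])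
  qed (use P in simp)
  have "sp s t (A1 \<union> (A2 \<union> B1 \<union> L \<union> B2))"
  proof (cases "A1 = {} \<and> s = u")
    case False
    then have A1: "sp s u A1" using A12(2) by metis
    then have "u \<in> Field A1" using sp_terminals by metis
    then have "Field A1 \<inter> Field (A2 \<union> B1 \<union> L \<union> B2) = {u}"
      unfolding Field_Un using AB' L'(1) nm(2) A12(4) mem(2) by blast
    then show ?thesis by (rule sp.sp_series[OF A1 Q])
  qed (use Q in simp)
  moreover have "A1 \<union> (A2 \<union> B1 \<union> L \<union> B2) = A \<union> B \<union> L"
    unfolding A12(1) B12(1) by (simp add: Un_ac)
  ultimately show ?thesis by simp
qed

text \<open>Induction pushes the ear into a component containing both of its ends; ears running
  between components are settled by \<open>parallel_ear_W\<close> and \<open>series_ear\<close>. The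
  last hypothesis keeps the ear from closing a cycle, and arc-disjointness keeps it from repeating
  an arc of \<open>M\<close>.\<close>

lemma sp_add_ear:
  assumes "sp s t M" "sp u v L" "Field M \<inter> Field L = {u, v}" "M \<inter> L = {}" "(v, u) \<notin> M\<^sup>*"
  shows "sp s t (M \<union> L) \<or> topological_minor W (M \<union> L)"
  using assms
proof (induction rule: sp.induct)
  case (sp_edge s t)
  have Fst: "Field {(s, t)} = {s, t}" by (auto simp: Field_def)
  have "u \<noteq> v" using sp_terminals[OF sp_edge.prems(1)] by metis
  moreover have "u \<in> {s, t}" "v \<in> {s, t}" using sp_edge.prems(2) Fst by auto
  moreover have "(v, u) \<noteq> (s, t)" using sp_edge.prems(4) by auto
  ultimately have uv: "u = s" "v = t" by auto
  have "sp s t ({(s, t)} \<union> L)"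
  proof (rule sp.sp_parallel[OF sp.sp_edge[OF sp_edge.hyps]])
    show "sp s t L" using sp_edge.prems(1) unfolding uv .
    show "Field {(s, t)} \<inter> Field L = {s, t}" using sp_edge.prems(2) unfolding uv .
    show "{(s, t)} \<inter> L = {}" using sp_edge.prems(3) .
  qed
  then show ?case unfolding uv ..
next
  case (sp_parallel s t A B)
  have acyc: "acyclic (A \<union> B)" using sp_acyclic[OF sp.sp_parallel[OF sp_parallel.hyps]] .
  have nA: "(v, u) \<notin> A\<^sup>*" "(v, u) \<notin> B\<^sup>*" 
    using sp_parallel.prems(4) rtrancl_subsetD[of v u A "A \<union> B"] rtrancl_subsetD[of v u B "A \<union> B"]
      by auto
  have uv: "u \<in> Field A \<union> Field B" "v \<in> Field A \<union> Field B"
    using sp_parallel.prems(2) by (auto simp: Field_Un)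
  have TL: "u \<in> Field L" "v \<in> Field L" using sp_terminals[OF sp_parallel.prems(1)] by auto
  have Lw: "w \<in> {u, v}" if "w \<in> Field L" "w \<in> Field A \<or> w \<in> Field B" for w
    using that sp_parallel.prems(2) by (auto simp: Field_Un)
  consider "u \<in> Field A" "v \<in> Field A" | "u \<in> Field B" "v \<in> Field B"
    | "u \<in> Field A" "u \<notin> Field B" "v \<in> Field B" "v \<notin> Field A"
    | "u \<in> Field B" "u \<notin> Field A" "v \<in> Field A" "v \<notin> Field B"
    using uv by blast
  then show ?case
  proof cases
    case 1
    have X: "Field A \<inter> Field L = {u, v}" "\<And>w. w \<in> Field L \<Longrightarrow> w \<in> Field B \<Longrightarrow> w \<in> {s, t}"
      using Lw TL 1 sp_parallel.hyps(3) by auto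
    have "sp s t (A \<union> L) \<or> topological_minor W (A \<union> L)"
      using sp_parallel.IH(1)[OF sp_parallel.prems(1) X(1) _ nA(1)] sp_parallel.prems(3) by auto
    then show ?thesis
    proof
      assume "sp s t (A \<union> L)"
      moreover have "Field (A \<union> L) \<inter> Field B = {s, t}"
        using X(2) sp_parallel.hyps(3) by (auto simp: Field_Un)
      moreover have "(A \<union> L) \<inter> B = {}" using sp_parallel.hyps(4) sp_parallel.prems(3) by blast
      ultimately have "sp s t (A \<union> L \<union> B)" using sp_parallel.hyps(2) sp.sp_parallel by metis
      then show ?thesis by (simp add: Un_ac)
    qed (auto intro: topological_minor_mono)
  next
    case 2
    have X: "Field B \<inter> Field L = {u, v}" "\<And>w. w \<in> Field L \<Longrightarrow> w \<in> Field A \<Longrightarrow> w \<in> {s, t}"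
      using Lw TL 2 sp_parallel.hyps(3) by auto
    have "sp s t (B \<union> L) \<or> topological_minor W (B \<union> L)"
      using sp_parallel.IH(2)[OF sp_parallel.prems(1) X(1) _ nA(2)] sp_parallel.prems(3) by auto
    then show ?thesis
    proof
      assume "sp s t (B \<union> L)"
      moreover have "Field A \<inter> Field (B \<union> L) = {s, t}"
        using X(2) sp_parallel.hyps(3) by (auto simp: Field_Un)
      moreover have "A \<inter> (B \<union> L) = {}" using sp_parallel.hyps(4) sp_parallel.prems(3) by blast
      ultimately have "sp s t (A \<union> (B \<union> L))" using sp_parallel.hyps(1) sp.sp_parallel by metis
      then show ?thesis by (simp add: Un_ac)
    qed (auto intro: topological_minor_mono)
  next
    case 3
    then show ?thesis
      using parallel_ear_W[OF sp_parallel.hyps(1-3) sp_parallel.prems(1,2,4) _ _ _ _ acyc] by blast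
  next
    case 4
    have "Field B \<inter> Field A = {s, t}" "B \<union> A = A \<union> B" using sp_parallel.hyps(3) by auto
    then show ?thesis
      using parallel_ear_W[OF sp_parallel.hyps(2,1), of u v L] sp_parallel.prems(1,2,4) 4 acyc by auto
  qed
next
  case (sp_series s m A t B)
  have acyc: "acyclic (A \<union> B)" using sp_acyclic[OF sp.sp_series[OF sp_series.hyps]] .
  have nA: "(v, u) \<notin> A\<^sup>*" "(v, u) \<notin> B\<^sup>*" 
    using sp_series.prems(4) rtrancl_subsetD[of v u A "A \<union> B"] rtrancl_subsetD[of v u B "A \<union> B"] by auto
  have uv: "u \<in> Field A \<union> Field B" "v \<in> Field A \<union> Field B"
    using sp_series.prems(2) by (auto simp: Field_Un)
  have TL: "u \<in> Field L" "v \<in> Field L" using sp_terminals[OF sp_series.prems(1)] by auto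
  have Lw: "w \<in> {u, v}" if "w \<in> Field L" "w \<in> Field A \<or> w \<in> Field B" for w
    using that sp_series.prems(2) by (auto simp: Field_Un)
  have m: "m \<in> Field A" "m \<in> Field B" using sp_series.hyps(3) by auto
  consider "u \<in> Field A" "v \<in> Field A" | "u \<in> Field B" "v \<in> Field B"
    | "u \<in> Field A" "u \<noteq> m" "v \<in> Field B" "v \<noteq> m"
    | "u \<in> Field B" "v \<in> Field A"
    using uv m by blast
  then show ?case
  proof cases
    case 1
    have X: "Field A \<inter> Field L = {u, v}" "\<And>w. w \<in> Field L \<Longrightarrow> w \<in> Field B \<Longrightarrow> w \<in> {m}"
      using Lw TL 1 sp_series.hyps(3) by auto
    have "sp s m (A \<union> L) \<or> topological_minor W (A \<union> L)"
      using sp_series.IH(1)[OF sp_series.prems(1) X(1) _ nA(1)] sp_series.prems(3) by auto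
    then show ?thesis
    proof
      assume "sp s m (A \<union> L)"
      moreover have "Field (A \<union> L) \<inter> Field B = {m}" using X(2) sp_series.hyps(3) by (auto simp: Field_Un)
      ultimately have "sp s t (A \<union> L \<union> B)" using sp_series.hyps(2) sp.sp_series by metis
      then show ?thesis by (simp add: Un_ac)
    qed (auto intro: topological_minor_mono)
  next
    case 2
    have X: "Field B \<inter> Field L = {u, v}" "\<And>w. w \<in> Field L \<Longrightarrow> w \<in> Field A \<Longrightarrow> w \<in> {m}"
      using Lw TL 2 sp_series.hyps(3) by auto
    have "sp m t (B \<union> L) \<or> topological_minor W (B \<union> L)"
      using sp_series.IH(2)[OF sp_series.prems(1) X(1) _ nA(2)] sp_series.prems(3) by auto
    then show ?thesis
    proof
      assume "sp m t (B \<union> L)"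
      moreover have "Field A \<inter> Field (B \<union> L) = {m}" using X(2) sp_series.hyps(3) by (auto simp: Field_Un)
      ultimately have "sp s t (A \<union> (B \<union> L))" using sp_series.hyps(1) sp.sp_series by metis
      then show ?thesis by (simp add: Un_ac)
    qed (auto intro: topological_minor_mono)
  next
    case 3
    then show ?thesis
      using series_ear[OF sp_series.hyps(1-3) sp_series.prems(1-4) _ _ _ _ acyc] by blast
  next
    case 4
    \<comment> \<open>A backward ear is impossible, since \<open>v\<close> would reach
      \<open>u\<close> through \<open>m\<close>.\<close>
    have "(v, m) \<in> (A \<union> B)\<^sup>*" "(m, u) \<in> (A \<union> B)\<^sup>*"
      using rtrancl_subsetD[OF sp_reach(2)[OF sp_series.hyps(1) 4(2)]]
        rtrancl_subsetD[OF sp_reach(1)[OF sp_series.hyps(2) 4(1)]] by auto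
    then show ?thesis using sp_series.prems(4) by (meson rtrancl_trans)
  qed
qed

section \<open>Ears of maximal series-parallel subgraphs\<close>

text \<open>Arcs are indexed by their tails, hence the half-open interval for arcs and the closed
  one for vertices.\<close>

lemma Field_segment:
  assumes "i < j"
  shows "Field ((\<lambda>k. (f k, f (Suc k))) ` {i..<j}) = f ` {i..j}"
proof -
  have "Field ((\<lambda>k. (f k, f (Suc k))) ` {i..<j}) = f ` ({i..<j} \<union> Suc ` {i..<j})"
  proof -
    have "Domain ((\<lambda>k. (f k, f (Suc k))) ` A) = f ` A" "Range ((\<lambda>k. (f k, f (Suc k))) ` A) = f ` Suc ` A" for A
      by force+
    then show ?thesis by (simp add: Field_def image_Un)
  qed
  also have "{i..<j} \<union> Suc ` {i..<j} = {i..j}" using assms by auto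
  finally show ?thesis .
qed

lemma sp_segment:
  assumes "i < j" "inj_on f {i..j}"
  shows "sp (f i) (f j) ((\<lambda>k. (f k, f (Suc k))) ` {i..<j})"
  using assms
proof (induction j)
  case (Suc j)
  have ne: "f j \<noteq> f (Suc j)" using inj_onD[OF Suc.prems(2), of j "Suc j"] Suc.prems(1) by auto
  show ?case
  proof (cases "i = j")
    case True
    then show ?thesis using ne sp_edge by simp
  next
    case False
    then have "i < j" using Suc.prems by simp
    have "inj_on f {i..j}" using Suc.prems(2) by (rule inj_on_subset) auto
    then have IH: "sp (f i) (f j) ((\<lambda>k. (f k, f (Suc k))) ` {i..<j})" using Suc.IH \<open>i < j\<close> by blast
    have "f (Suc j) \<noteq> f l" if "l \<in> {i..j}" for l
      using inj_onD[OF Suc.prems(2), of "Suc j" l] that by auto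
    then have "f (Suc j) \<notin> f ` {i..j}" by (metis imageE)
    then have "f ` {i..j} \<inter> Field {(f j, f (Suc j))} = {f j}"
      using \<open>i < j\<close> by (auto simp: Field_def)
    then have "sp (f i) (f (Suc j)) ((\<lambda>k. (f k, f (Suc k))) ` {i..<j} \<union> {(f j, f (Suc j))})"
      using sp_series[OF IH sp_edge[OF ne]] Field_segment[OF \<open>i < j\<close>, of f] by simp
    moreover have "{i..<Suc j} = insert j {i..<j}" using \<open>i < j\<close> by auto
    ultimately show ?thesis by simp
  qed
qed simp

lemma maximal_sp_contains_path:
  assumes M: "sp s t M" "M \<subseteq> E"
    and maximal: "\<And>N. sp s t N \<Longrightarrow> M \<subseteq> N \<Longrightarrow> N \<subseteq> E \<Longrightarrow> N = M"
    and noW: "\<not> topological_minor W E"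
    and f: "f 0 = s" "f n = t" "inj_on f {..n}" "\<And>k. k < n \<Longrightarrow> (f k, f (Suc k)) \<in> E"
    and "k < n"
  shows "(f k, f (Suc k)) \<in> M"
proof (rule ccontr)
  assume "(f k, f (Suc k)) \<notin> M"
  \<comment> \<open>\<open>f i\<close> is the vertex at which the path first leaves
    \<open>M\<close>.\<close>
  define i where "i = (LEAST k. k < n \<and> (f k, f (Suc k)) \<notin> M)"
  have i: "i < n" "(f i, f (Suc i)) \<notin> M"
    using LeastI[of "\<lambda>k. k < n \<and> (f k, f (Suc k)) \<notin> M" k] \<open>k < n\<close> \<open>(f k, _) \<notin> M\<close>
    unfolding i_def by auto
  have less: "(f l, f (Suc l)) \<in> M" if "l < i" for l
    using not_less_Least[of l "\<lambda>k. k < n \<and> (f k, f (Suc k)) \<notin> M"] that i(1) unfolding i_def by auto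
  have inj: "l = l'" if "f l = f l'" "l \<le> n" "l' \<le> n" for l l'
    using inj_onD[OF f(3) that(1)] that by simp
  note T = sp_terminals[OF M(1)] and acyc = sp_acyclic[OF M(1)]
  have prefix: "(f 0, f l) \<in> (Restr M X)\<^sup>*" if "l \<le> i" "f ` {..i} \<subseteq> X" for l X
    using that(1)
  proof (induction l)
    case (Suc l)
    then have "(f l, f (Suc l)) \<in> Restr M X" using less that(2) by auto
    then show ?case using Suc by (meson Suc_leD rtrancl_into_rtrancl)
  qed simp
  have suffix: "(f l, f i) \<in> M\<^sup>*" if "l \<le> i" for l
    using that
  proof (induction rule: inc_induct)
    case (step m)
    then show ?case using less by (meson converse_rtrancl_into_rtrancl)
  qed simp
  have fi: "f i \<in> Field M"
    using suffix[of 0] T f(1) rtrancl_Field[of s "f i" M] by (cases "f i = s") auto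
  \<comment> \<open>Strong induction along the path: if \<open>j\<close> is the last earlier index,
    from \<open>i\<close> on, with \<open>f j\<close> in \<open>M\<close>, the segment from
    \<open>j\<close> to \<open>l\<close> is either one arc of \<open>M\<close> or an ear of
    \<open>M\<close>. Both cases are refuted when \<open>f l\<close> does not reach
    \<open>f i\<close>.\<close>
  have descend: "l \<le> n \<Longrightarrow> i < l \<Longrightarrow> f l \<in> Field M \<Longrightarrow> (f l, f i) \<in> M\<^sup>*" for l
  proof (induction l rule: less_induct)
    case (less l)
    define J where "J = {j. i \<le> j \<and> j < l \<and> f j \<in> Field M}"
    have J: "finite J" "i \<in> J" using fi less.prems by (auto simp: J_def)
    define j where "j = Max J"
    have "j \<in> J" unfolding j_def using J Max_in by blast
    then have j: "i \<le> j" "j < l" "f j \<in> Field M" by (auto simp: J_def)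
    have between: "f m \<notin> Field M" if "j < m" "m < l" for m
    proof
      assume "f m \<in> Field M"
      then have "m \<in> J" using that j by (auto simp: J_def)
      then have "m \<le> j" unfolding j_def using J(1) by simp
      then show False using that by simp
    qed
    have ji: "(f j, f i) \<in> M\<^sup>*" using less.IH[of j] j less.prems by (cases "j = i") auto
    show ?case
    proof (rule ccontr)
      assume notle: "(f l, f i) \<notin> M\<^sup>*"
      have "topological_minor W M \<or> topological_minor W E"
      proof (cases "l = Suc j \<and> (f j, f l) \<in> M")
        case True
        then have "i < j" using i(2) j(1) by (cases "i = j") auto
        \<comment> \<open>The initial part of the path up to \<open>f i\<close> stays in
          \<open>A\<close>: its vertices reach \<open>f i\<close>, and injectivity keeps
          \<open>f j\<close> off it. The route from \<open>f j\<close> over \<open>f l\<close> to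
          \<open>t\<close> stays in \<open>B\<close>, because \<open>f l\<close> does not reach
          \<open>f i\<close>.\<close>
        define A where "A = {w. (w, f i) \<in> M\<^sup>*} - {f j}"
        define B where "B = insert (f j) {w. (w, f i) \<notin> M\<^sup>*}"
        have nj: "f m \<noteq> f j" if "m \<le> i" for m using inj[of m j] that \<open>i < j\<close> j less.prems by auto
        have pre: "f ` {..i} \<subseteq> A" using suffix nj by (auto simp: A_def)
        have "t \<noteq> f i" using inj[of n i] i(1) f(2) by auto
        then have "(t, f i) \<notin> M\<^sup>*" using rtrancl_outside_Field[of t "f i" M] T by auto
        then have "t \<in> B" by (simp add: B_def)
        have "(f l, t) \<in> (Restr M B)\<^sup>*"
        proof (rule rtrancl_in_Restr_interval[OF sp_reach(2)[OF M(1) less.prems(3)]])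
          fix w assume "(f l, w) \<in> M\<^sup>*"
          then have "(w, f i) \<notin> M\<^sup>*" using notle by (meson rtrancl_trans)
          then show "w \<in> B" by (simp add: B_def)
        qed simp
        moreover have "(f j, f l) \<in> Restr M B" using True notle by (auto simp: B_def)
        ultimately have jt: "(f j, t) \<in> (Restr M B)\<^sup>*" by (meson converse_rtrancl_into_rtrancl)
        have "topological_minor W M"
        proof (rule W_topological_minor_crossing[OF acyc])
          show "A \<inter> B = {}" by (auto simp: A_def B_def)
          show "s \<in> A" "f i \<in> A" using pre f(1) by auto
          show "f j \<in> B" by (simp add: B_def)
          show "t \<in> B" by fact
          show "(s, f i) \<in> (Restr M A)\<^sup>*" using prefix[OF _ pre, of i] f(1) by simp
          show "(f j, t) \<in> (Restr M B)\<^sup>*" by fact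
          show "(s, f j) \<in> M\<^sup>*" using sp_reach(1)[OF M(1) j(3)] .
          show "(f j, f i) \<in> M\<^sup>*" by fact
          show "(f i, t) \<in> M\<^sup>*" using sp_reach(2)[OF M(1) fi] .
        qed
        then show ?thesis ..
      next
        case False
        define L where "L = (\<lambda>k. (f k, f (Suc k))) ` {j..<l}"
        have "inj_on f {j..l}" using f(3) by (rule inj_on_subset) (use less.prems in auto)
        then have L: "sp (f j) (f l) L" unfolding L_def using j(2) sp_segment by metis
        have FL: "Field L = f ` {j..l}" unfolding L_def using Field_segment[OF j(2)] .
        have ends: "Field M \<inter> Field L = {f j, f l}"
        proof
          show "Field M \<inter> Field L \<subseteq> {f j, f l}"
          proof
            fix w assume "w \<in> Field M \<inter> Field L"
            then obtain m where m: "w = f m" "j \<le> m" "m \<le> l" "f m \<in> Field M" using FL by auto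
            then have "m = j \<or> m = l" using between[of m] by (cases "m = j"; cases "m = l") auto
            then show "w \<in> {f j, f l}" using m(1) by auto
          qed
          show "{f j, f l} \<subseteq> Field M \<inter> Field L" using FL j less.prems(3) by auto
        qed
        \<comment> \<open>An arc of the segment lying in \<open>M\<close> would have both ends in
          \<open>M\<close>, so it would be the whole segment, which is the case already
          treated.\<close>
        have arcs_disj: "M \<inter> L = {}"
        proof (rule ccontr)
          assume "M \<inter> L \<noteq> {}"
          then obtain m where m: "j \<le> m" "m < l" "(f m, f (Suc m)) \<in> M" unfolding L_def by auto
          then have "f m \<in> Field M" "f (Suc m) \<in> Field M" by (auto intro: FieldI1 FieldI2)
          then have "m = j" "Suc m = l" using between[of m] between[of "Suc m"] m by force+
          then show False using False m(3) by auto
        qed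
        have "(f l, f j) \<notin> M\<^sup>*" using notle ji by (meson rtrancl_trans)
        then have ear: "sp s t (M \<union> L) \<or> topological_minor W (M \<union> L)"
          using sp_add_ear[OF M(1) L ends arcs_disj] by blast
        have sub: "M \<union> L \<subseteq> E" using M(2) f(4) less.prems(1) by (auto simp: L_def)
        have "L \<noteq> {}" using j(2) by (simp add: L_def)
        then have "M \<union> L \<noteq> M" using arcs_disj by auto
        then have "\<not> sp s t (M \<union> L)" using maximal[of "M \<union> L"] sub by auto
        then show ?thesis using ear topological_minor_mono[OF _ sub] by blast
      qed
      then show False using noW topological_minor_mono[OF _ M(2)] by blast
    qed
  qed
  \<comment> \<open>The path ends in \<open>t\<close>, a vertex of \<open>M\<close> with no outgoing
    arc in \<open>M\<close>, so \<open>t\<close> cannot reach the different vertex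
    \<open>f i\<close>.\<close>
  have "(t, f i) \<in> M\<^sup>*" using descend[of n] i(1) f(2) T by auto
  then have "t = f i" using rtrancl_outside_Field[of t "f i" M] T by auto
  then show False using inj[of n i] f(2) i(1) by auto
qed

section \<open>Walks and subdivisions\<close>

lemma pcas_ends:
  assumes "pcas u p v"
  shows "u \<in> set (pawalk_verts u p)" "v \<in> set (pawalk_verts u p)"
  using assms by (induction p arbitrary: u) auto

lemma pcas_verts_rtrancl:
  assumes "pcas u p v" "set p \<subseteq> F" "w \<in> set (pawalk_verts u p)"
  shows "(u, w) \<in> F\<^sup>*" "(w, v) \<in> F\<^sup>*"
proof -
  have "(u, w) \<in> F\<^sup>* \<and> (w, v) \<in> F\<^sup>*"
    using assms
  proof (induction p arbitrary: u w)
    case (Cons e p)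
    then have e: "(u, snd e) \<in> F" by auto
    have p: "pcas (snd e) p v" "set p \<subseteq> F" using Cons.prems by auto
    have "snd e \<in> set (pawalk_verts (snd e) p)" using pcas_ends(1)[OF p(1)] .
    then have "(u, v) \<in> F\<^sup>*" using Cons.IH[OF p] e by (meson converse_rtrancl_into_rtrancl)
    show ?case
    proof (cases "w = u")
      case True
      then show ?thesis using \<open>(u, v) \<in> F\<^sup>*\<close> by simp
    next
      case False
      then have "w \<in> set (pawalk_verts (snd e) p)" using Cons.prems by auto
      then show ?thesis using Cons.IH[OF p] e by (meson converse_rtrancl_into_rtrancl)
    qed
  qed simp
  then show "(u, w) \<in> F\<^sup>*" "(w, v) \<in> F\<^sup>*" by auto
qed

lemma pcas_acyclic_distinct:
  assumes "acyclic F" "pcas u p v" "set p \<subseteq> F"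
  shows "distinct (pawalk_verts u p)"
  using assms(2,3)
proof (induction p arbitrary: u)
  case (Cons e p)
  then have e: "(u, snd e) \<in> F" and p: "pcas (snd e) p v" "set p \<subseteq> F" by auto
  have "u \<notin> set (pawalk_verts (snd e) p)"
  proof
    assume "u \<in> set (pawalk_verts (snd e) p)"
    then have "(snd e, u) \<in> F\<^sup>*" using pcas_verts_rtrancl[OF p] by blast
    then have "(u, u) \<in> F\<^sup>+" using e by (meson rtrancl_into_trancl2)
    then show False using assms(1) by (auto simp: acyclic_def)
  qed
  then show ?case using Cons p by auto
qed simp

lemma pcas_suffix:
  assumes "pcas u p v" "distinct (pawalk_verts u p)" "w \<in> set (pawalk_verts u p)"
  shows "\<exists>q. pcas w q v \<and> set q \<subseteq> set p \<and> distinct (pawalk_verts w q)"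
  using assms
proof (induction p arbitrary: u)
  case (Cons e p)
  show ?case
  proof (cases "w = u")
    case True
    then show ?thesis using Cons.prems by blast
  next
    case False
    then have "\<exists>q. pcas w q v \<and> set q \<subseteq> set p \<and> distinct (pawalk_verts w q)"
      using Cons.prems by (intro Cons.IH[of "snd e"]) auto
    then show ?thesis by auto
  qed
qed (intro exI[of _ "[]"], auto)

text \<open>If the new first vertex already lies on the path, the suffix starting there replaces it,
  which keeps the vertices distinct.\<close>

lemma rtrancl_pcas:
  assumes "(u, v) \<in> F\<^sup>*"
  obtains p where "pcas u p v" "set p \<subseteq> F" "distinct (pawalk_verts u p)"
proof -
  have "\<exists>p. pcas u p v \<and> set p \<subseteq> F \<and> distinct (pawalk_verts u p)"
    using assms
  proof (induction rule: converse_rtrancl_induct)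
    case base
    then show ?case by (intro exI[of _ "[]"]) auto
  next
    case (step y z)
    then obtain p where p: "pcas z p v" "set p \<subseteq> F" "distinct (pawalk_verts z p)" by blast
    show ?case
    proof (cases "y \<in> set (pawalk_verts z p)")
      case True
      then show ?thesis using pcas_suffix[OF p(1,3) True] p(2) by blast
    next
      case False
      then show ?thesis using p step(1) by (intro exI[of _ "(y, z) # p"]) auto
    qed
  qed
  then show ?thesis using that by blast
qed

lemma pcas_rtrancl_Restr:
  assumes "pcas u p v" "set p \<subseteq> E" "set (pawalk_verts u p) \<subseteq> X"
  shows "(u, v) \<in> (Restr E X)\<^sup>*"
  using assms
proof (induction p arbitrary: u)
  case (Cons e p)
  have "snd e \<in> set (pawalk_verts (snd e) p)" using Cons.prems(1) by (cases p) auto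
  then have "(u, snd e) \<in> Restr E X" using Cons.prems by auto
  then show ?case using Cons by (auto intro: converse_rtrancl_into_rtrancl)
qed simp

lemma pcas_append:
  assumes "pcas u p v" "pcas v q w"
  shows "pcas u (p @ q) w" "set (pawalk_verts u (p @ q)) = set (pawalk_verts u p) \<union> set (pawalk_verts v q)"
    "distinct (pawalk_verts u p) \<Longrightarrow> distinct (pawalk_verts v q) \<Longrightarrow>
      set (pawalk_verts u p) \<inter> set (pawalk_verts v q) \<subseteq> {v} \<Longrightarrow> distinct (pawalk_verts u (p @ q))"
proof -
  show "pcas u (p @ q) w" using assms by (induction p arbitrary: u) auto
  have verts: "set (pawalk_verts u (p @ q)) = set (pawalk_verts u p) \<union> set (pawalk_verts v q)"
    if "pcas u p v" for u p
    using that
  proof (induction p arbitrary: u)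
    case Nil
    then show ?case using pcas_ends(1)[OF assms(2)] by auto
  qed auto
  show "set (pawalk_verts u (p @ q)) = set (pawalk_verts u p) \<union> set (pawalk_verts v q)"
    using verts[OF assms(1)] .
  assume "distinct (pawalk_verts u p)" "distinct (pawalk_verts v q)"
    "set (pawalk_verts u p) \<inter> set (pawalk_verts v q) \<subseteq> {v}"
  then show "distinct (pawalk_verts u (p @ q))"
    using assms(1)
  proof (induction p arbitrary: u)
    case (Cons e p)
    have p: "pcas (snd e) p v" using Cons.prems by auto
    have "fst e \<noteq> v" using Cons.prems(1) pcas_ends(2)[OF p] by auto
    then have "fst e \<notin> set (pawalk_verts v q)" using Cons.prems(3) by auto
    then show ?case using Cons p verts[OF p] by auto
  qed simp
qed

lemma apath_with_proj_iff:
  "pre_digraph.apath (with_proj G) u p v \<longleftrightarrow>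
    u \<in> pverts G \<and> set p \<subseteq> parcs G \<and> pcas u p v \<and> distinct (pawalk_verts u p)"
  by (auto simp: pre_digraph.apath_def pre_digraph.awalk_def cas_with_proj_eq awalk_verts_with_proj_eq)

section \<open>Path subgraphs and subdivisions\<close>

text \<open>Each arc extends inside \<open>M\<close> to a walk from \<open>s\<close> to
  \<open>t\<close>, and acyclicity of \<open>M\<close> makes this walk a path.\<close>

lemma sp_subset_path_arcs:
  assumes "pair_wf_digraph G" "sp s t M" "M \<subseteq> parcs G"
  shows "M \<subseteq> path_arcs G s t"
proof
  interpret pair_wf_digraph G by fact
  fix e assume "e \<in> M"
  obtain x y where e: "e = (x, y)" by fastforce
  have "(s, x) \<in> M\<^sup>*" "(y, t) \<in> M\<^sup>*"
    using sp_reach[OF assms(2)] \<open>e \<in> M\<close> unfolding e by (blast intro: FieldI1 FieldI2)+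
  then obtain p q where p: "pcas s p x" "set p \<subseteq> M" and q: "pcas y q t" "set q \<subseteq> M"
    using rtrancl_pcas by metis
  have "pcas x (e # q) t" using q(1) by (simp add: e)
  then have pq: "pcas s (p @ e # q) t" using p(1) pcas_append(1) by metis
  have sub: "set (p @ e # q) \<subseteq> M" using p q \<open>e \<in> M\<close> by auto
  have "distinct (pawalk_verts s (p @ e # q))"
    using pcas_acyclic_distinct[OF sp_acyclic[OF assms(2)] pq sub] .
  moreover have "s \<in> pverts G"
    using sp_terminals[OF assms(2)] assms(3) arc_fst_in_verts by (force simp: Field_def)
  ultimately have "pre_digraph.apath (with_proj G) s (p @ e # q) t"
    using pq sub assms(3) by (auto simp: apath_with_proj_iff)
  then show "e \<in> path_arcs G s t" unfolding path_arcs_def by force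
qed

lemma pawalk_verts_nth:
  assumes "pcas u p v"
  shows "length (pawalk_verts u p) = Suc (length p)" "pawalk_verts u p ! 0 = u"
    "pawalk_verts u p ! length p = v"
    "k < length p \<Longrightarrow> p ! k = (pawalk_verts u p ! k, pawalk_verts u p ! Suc k)"
proof -
  show "length (pawalk_verts u p) = Suc (length p)" by (induction p arbitrary: u) auto
  have hd: "pawalk_verts u p ! 0 = u" if "pcas u p v" for u p using that by (cases p) auto
  then show "pawalk_verts u p ! 0 = u" using assms .
  show "pawalk_verts u p ! length p = v" using assms by (induction p arbitrary: u) auto
  show "p ! k = (pawalk_verts u p ! k, pawalk_verts u p ! Suc k)" if "k < length p"
    using assms that
  proof (induction p arbitrary: u k)
    case (Cons e p)
    then show ?case using hd[of "snd e" p] by (cases k) auto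
  qed simp
qed

text \<open>A single path is series-parallel, so by finiteness there is a maximal series-parallel
  \<open>M\<close>. It contains every path from \<open>s\<close> to \<open>t\<close> and consists of
  arcs on such paths, so it equals \<open>path_arcs G s t\<close>.\<close>

lemma dsp_path_subgraph:
  assumes "pair_digraph G" "\<not> topological_minor W (parcs G)" "path_arcs G s t \<noteq> {}"
  shows "dsp s t (path_subgraph G s t)"
proof -
  interpret pair_digraph G by fact
  have path: "\<exists>f n. f 0 = s \<and> f n = t \<and> inj_on f {..n} \<and> (\<forall>k<n. (f k, f (Suc k)) \<in> parcs G) \<and>
      (\<exists>k<n. e = (f k, f (Suc k)))" if e: "e \<in> path_arcs G s t" for e
  proof -
    obtain p where p: "set p \<subseteq> parcs G" "pcas s p t" "distinct (pawalk_verts s p)" "e \<in> set p"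
      using e unfolding path_arcs_def apath_with_proj_iff by blast
    note nth = pawalk_verts_nth[OF p(2)]
    have "inj_on ((!) (pawalk_verts s p)) {..length p}"
      using p(3) by (intro inj_on_nth) (auto simp: nth(1))
    moreover have "\<forall>k<length p. (pawalk_verts s p ! k, pawalk_verts s p ! Suc k) \<in> parcs G"
      using nth(4) p(1) nth_mem by (metis subsetD)
    moreover have "\<exists>k<length p. e = (pawalk_verts s p ! k, pawalk_verts s p ! Suc k)"
      using nth(4) p(4) by (metis in_set_conv_nth)
    ultimately show ?thesis using nth(2,3)
      by (intro exI[of _ "(!) (pawalk_verts s p)"] exI[of _ "length p"]) simp
  qed
  define S where "S = {M. sp s t M \<and> M \<subseteq> parcs G}"
  have "S \<noteq> {}"
  proof -
    obtain e where "e \<in> path_arcs G s t" using assms(3) by blast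
    then obtain f n k where f: "f 0 = s" "f n = t" "inj_on f {..n}" "\<forall>k<n. (f k, f (Suc k)) \<in> parcs G" "k < n"
      using path by metis
    then have "sp s t ((\<lambda>k. (f k, f (Suc k))) ` {0..<n})"
      using sp_segment[of 0 n f] by (simp add: atLeast0AtMost)
    then show ?thesis using f(4) unfolding S_def by auto
  qed
  moreover have "finite S"
    by (rule finite_subset[of _ "Pow (parcs G)"]) (auto simp: S_def pair_finite_arcs)
  ultimately obtain M where M: "M \<in> S" "\<And>N. N \<in> S \<Longrightarrow> M \<subseteq> N \<Longrightarrow> M = N"
    using finite_has_maximal by metis
  have "path_arcs G s t \<subseteq> M"
  proof
    fix e assume "e \<in> path_arcs G s t"
    then obtain f n k where f: "f 0 = s" "f n = t" "inj_on f {..n}" "\<forall>k<n. (f k, f (Suc k)) \<in> parcs G"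
        "k < n" "e = (f k, f (Suc k))"
      using path by metis
    show "e \<in> M" unfolding f(6)
      by (rule maximal_sp_contains_path[OF _ _ _ assms(2) f(1-3) _ f(5)])
        (use M f(4) in \<open>auto simp: S_def\<close>)
  qed
  moreover have "M \<subseteq> path_arcs G s t"
    using M(1) sp_subset_path_arcs[OF pair_wf_digraph] by (auto simp: S_def)
  ultimately have "sp s t (path_arcs G s t)" using M(1) by (auto simp: S_def)
  then show ?thesis by (simp add: dsp_iff_sp path_subgraph_def)
qed

text \<open>A path chosen inside each \<open>X e\<close> has its inner vertices in
  \<open>X e\<close> and off the corners, where these sets are disjoint. \<open>H\<close> is the
  union of the chosen paths.\<close>

lemma subdivision_of_topological_minor:
  fixes K :: "'k pair_pre_digraph" and G :: "'a pair_pre_digraph"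
  assumes "pair_wf_digraph G" "pverts K = Field (parcs K)" "irrefl (parcs K)"
    "topological_minor K (parcs G)"
  shows "\<exists>H :: 'a pair_pre_digraph. subgraph (with_proj H) (with_proj G) \<and> subdivision_of K H"
proof -
  interpret pair_wf_digraph G by fact
  obtain f :: "'k \<Rightarrow> 'a" and X where inj: "inj_on f (pverts K)"
    and fX: "\<forall>(x, y) \<in> parcs K. (f x, f y) \<in> (Restr (parcs G) (X (x, y)))\<^sup>* \<and>
      X (x, y) \<inter> f ` pverts K \<subseteq> {f x, f y}"
    and disj: "\<forall>e \<in> parcs K. \<forall>e' \<in> parcs K. e \<noteq> e' \<longrightarrow> X e \<inter> X e' \<subseteq> f ` pverts K"
    using assms(4) unfolding topological_minor_def by (elim exE conjE) (rule that)
  have reach: "(f x, f y) \<in> (Restr (parcs G) (X (x, y)))\<^sup>*"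
    and X: "X (x, y) \<inter> f ` pverts K \<subseteq> {f x, f y}" if "(x, y) \<in> parcs K" for x y
    using bspec[OF fX that] unfolding prod.case by (rule conjunct1, rule conjunct2)
  have "\<forall>e\<in>parcs K. \<exists>p. pcas (f (fst e)) p (f (snd e)) \<and> set p \<subseteq> Restr (parcs G) (X e) \<and>
      distinct (pawalk_verts (f (fst e)) p)"
  proof
    fix e assume "e \<in> parcs K"
    then have "(f (fst e), f (snd e)) \<in> (Restr (parcs G) (X e))\<^sup>*"
      using reach[of "fst e" "snd e"] by simp
    then show "\<exists>p. pcas (f (fst e)) p (f (snd e)) \<and> set p \<subseteq> Restr (parcs G) (X e) \<and>
      distinct (pawalk_verts (f (fst e)) p)"
      by (rule rtrancl_pcas) blast
  qed
  then obtain P where P_all: "\<forall>e\<in>parcs K. pcas (f (fst e)) (P e) (f (snd e)) \<and>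
      set (P e) \<subseteq> Restr (parcs G) (X e) \<and> distinct (pawalk_verts (f (fst e)) (P e))"
    unfolding bchoice_iff by (elim exE) (rule that)
  have P: "pcas (f x) (P (x, y)) (f y)" "set (P (x, y)) \<subseteq> Restr (parcs G) (X (x, y))"
    "distinct (pawalk_verts (f x) (P (x, y)))" if "(x, y) \<in> parcs K" for x y
    using bspec[OF P_all that] by auto
  \<comment> \<open>An empty path would identify the images of the two ends of the arc, against
    injectivity of \<open>f\<close> and irreflexivity of \<open>K\<close>.\<close>
  have ne: "P (x, y) \<noteq> []" if "(x, y) \<in> parcs K" for x y
  proof
    assume "P (x, y) = []"
    then have "f x = f y" using P(1)[OF that] by simp
    moreover have "x \<in> pverts K" "y \<in> pverts K" using that assms(2) by (auto intro: FieldI1 FieldI2)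
    ultimately have "x = y" using inj by (auto dest: inj_onD)
    then show False using that assms(3) by (auto simp: irrefl_def)
  qed
  have inner: "inner_verts (P (x, y)) (f x) (f y) \<subseteq> X (x, y) - f ` pverts K"
    if "(x, y) \<in> parcs K" for x y
  proof
    fix w assume w: "w \<in> inner_verts (P (x, y)) (f x) (f y)"
    then have "(f x, w) \<in> (Restr (parcs G) (X (x, y)))\<^sup>*" "w \<noteq> f x" "w \<noteq> f y"
      using pcas_verts_rtrancl(1)[OF P(1,2)[OF that]] by (auto simp: inner_verts_def)
    then have "w \<in> X (x, y)" by (auto elim: rtranclE)
    then show "w \<in> X (x, y) - f ` pverts K" using X[OF that] \<open>w \<noteq> f x\<close> \<open>w \<noteq> f y\<close> by blast
  qed
  define H where "H = \<lparr>pverts = f ` pverts K \<union> (\<Union>(x, y) \<in> parcs K. set (pawalk_verts (f x) (P (x, y)))),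
    parcs = (\<Union>e \<in> parcs K. set (P e))\<rparr>"
  have parcs: "parcs H \<subseteq> parcs G"
  proof
    fix a assume "a \<in> parcs H"
    then obtain e where "e \<in> parcs K" "a \<in> set (P e)" unfolding H_def by auto
    then show "a \<in> parcs G" using P(2)[of "fst e" "snd e"] by auto
  qed
  have vertsP: "set (pawalk_verts (f x) (P (x, y))) = Field (set (P (x, y)))"
    if "(x, y) \<in> parcs K" for x y
    using set_awalk_verts_not_Nil_cas[OF P(1)[OF that] ne[OF that]]
    by (simp add: Field_def Domain_fst Range_snd)
  have endP: "f x \<in> Field (set (P (x, y)))" "f y \<in> Field (set (P (x, y)))" if "(x, y) \<in> parcs K" for x y
    using pcas_ends[OF P(1)[OF that]] unfolding vertsP[OF that] .
  have "f ` pverts K \<subseteq> Field (parcs H)"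
  proof
    fix w assume "w \<in> f ` pverts K"
    then obtain x y where xy: "(x, y) \<in> parcs K" "w = f x \<or> w = f y"
      using assms(2) by (auto simp: Field_def)
    then have "w \<in> Field (set (P (x, y)))" using endP by auto
    then show "w \<in> Field (parcs H)" using xy(1) by (fastforce simp: H_def Field_def)
  qed
  moreover have "(\<Union>(x, y) \<in> parcs K. set (pawalk_verts (f x) (P (x, y)))) = Field (parcs H)"
    using vertsP by (fastforce simp: H_def Field_def)
  moreover have "pverts H = f ` pverts K \<union> (\<Union>(x, y) \<in> parcs K. set (pawalk_verts (f x) (P (x, y))))"
    by (simp add: H_def)
  ultimately have pverts: "pverts H = Field (parcs H)" by (simp only: Un_absorb1)
  have "pair_wf_digraph H"
    by (rule pair_wf_digraph.intro; unfold pverts) (metis FieldI1 FieldI2 prod.collapse)+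
  moreover have "Field (parcs G) \<subseteq> pverts G" by (auto simp: Field_def dest: in_arcsD1 in_arcsD2)
  then have "pverts H \<subseteq> pverts G"
    using mono_Field[OF parcs] unfolding pverts by (rule order_trans[rotated])
  ultimately have "subgraph (with_proj H) (with_proj G)"
    using parcs assms(1) by (simp add: subgraph_def wf_digraph_wp_iff compatible_def)
  moreover have "subdivision_of K H"
    unfolding subdivision_of_def
  proof (intro exI[of _ f] exI[of _ P] conjI ballI case_prodI2 impI)
    fix e x y assume "e \<in> parcs K" "e = (x, y)"
    then have xy: "(x, y) \<in> parcs K" by simp
    show "P (x, y) \<noteq> []" using ne[OF xy] .
    show "pre_digraph.apath (with_proj H) (f x) (P (x, y)) (f y)"
      unfolding apath_with_proj_iff
    proof (intro conjI)
      show "f x \<in> pverts H" using xy assms(2) by (auto simp: H_def intro: FieldI1)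
      show "set (P (x, y)) \<subseteq> parcs H" using xy by (auto simp: H_def)
    qed (use P[OF xy] in simp_all)
    show "inner_verts (P (x, y)) (f x) (f y) \<inter> f ` pverts K = {}" using inner[OF xy] by blast
    fix e' x' y' assume "e' \<in> parcs K" "e' = (x', y')" and neq: "(x, y) \<noteq> (x', y')"
    then have xy': "(x', y') \<in> parcs K" by simp
    show "inner_verts (P (x, y)) (f x) (f y) \<inter> inner_verts (P (x', y')) (f x') (f y') = {}"
      using inner[OF xy] inner[OF xy'] bspec[OF bspec[OF disj xy] xy'] neq by blast
  qed (use inj in \<open>simp_all add: H_def\<close>)
  ultimately show ?thesis by blast
qed

lemma subdivision_W_not_P1:
  assumes "pair_digraph G" "subgraph (with_proj H) (with_proj G)" "subdivision_of W H"
  shows "\<not> property_P1 G"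
proof
  assume P1: "property_P1 G"
  obtain f P where inj: "inj_on f (pverts W)"
    and P: "\<forall>(x, y) \<in> parcs W. P (x, y) \<noteq> [] \<and>
        pre_digraph.apath (with_proj H) (f x) (P (x, y)) (f y) \<and>
        inner_verts (P (x, y)) (f x) (f y) \<inter> f ` pverts W = {}"
    and disj: "\<forall>(x, y) \<in> parcs W. \<forall>(x', y') \<in> parcs W. (x, y) \<noteq> (x', y') \<longrightarrow>
        inner_verts (P (x, y)) (f x) (f y) \<inter> inner_verts (P (x', y')) (f x') (f y') = {}"
    using assms(3) unfolding subdivision_of_def by (elim exE conjE) (rule that)
  have HG: "pverts H \<subseteq> pverts G" "parcs H \<subseteq> parcs G" using assms(2) by (auto simp: subgraph_def)
  define V where "V = (\<lambda>x y. set (pawalk_verts (f x) (P (x, y))))"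
  define I where "I = (\<lambda>x y. inner_verts (P (x, y)) (f x) (f y))"
  have path: "pcas (f x) (P (x, y)) (f y)" "distinct (pawalk_verts (f x) (P (x, y)))"
      "set (P (x, y)) \<subseteq> parcs G" "f x \<in> pverts G" "f y \<in> pverts G" "P (x, y) \<noteq> []"
    and V: "V x y = insert (f x) (insert (f y) (I x y))"
    and I: "I x y \<inter> f ` pverts W = {}" if "(x, y) \<in> parcs W" for x y
  proof -
    have a: "P (x, y) \<noteq> []" "pre_digraph.apath (with_proj H) (f x) (P (x, y)) (f y)"
        "I x y \<inter> f ` pverts W = {}"
      using bspec[OF P that] unfolding I_def by simp_all
    then show "I x y \<inter> f ` pverts W = {}" "P (x, y) \<noteq> []" by auto
    show p: "pcas (f x) (P (x, y)) (f y)" "distinct (pawalk_verts (f x) (P (x, y)))"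
      "set (P (x, y)) \<subseteq> parcs G" "f x \<in> pverts G"
      using a(2) HG unfolding apath_with_proj_iff by auto
    show "V x y = insert (f x) (insert (f y) (I x y))"
      using pcas_ends[OF p(1)] unfolding V_def I_def inner_verts_def by auto
    interpret pair_digraph G by fact
    show "f y \<in> pverts G"
      using p(1,3,4) awalk_last_in_verts[of "f x" "P (x, y)" "f y"] by (simp add: awalk_def)
  qed
  let ?a = "f Wa" and ?b = "f Wb" and ?c = "f Wc" and ?d = "f Wd"
  have arcs: "(Wa, Wb) \<in> parcs W" "(Wa, Wc) \<in> parcs W" "(Wb, Wd) \<in> parcs W" "(Wc, Wd) \<in> parcs W" "(Wb, Wc) \<in> parcs W"
    by (auto simp: W_def)
  have ne: "?a \<noteq> ?b" "?a \<noteq> ?c" "?a \<noteq> ?d" "?b \<noteq> ?c" "?b \<noteq> ?d" "?c \<noteq> ?d"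
    using inj by (auto simp: W_def inj_on_def)
  note V' = arcs[THEN V]
  have img: "f ` pverts W = {?a, ?b, ?c, ?d}" by (simp add: W_def)
  \<comment> \<open>Inner vertices are never corners and are not shared, so a vertex common to two
    branch paths is an end of both.\<close>
  have capV: "V u v \<inter> V u' v' \<subseteq> {f u, f v} \<inter> {f u', f v'}"
    if arcs: "(u, v) \<in> parcs W" "(u', v') \<in> parcs W" "(u, v) \<noteq> (u', v')" for u v u' v'
  proof
    have ends: "{f u, f v} \<subseteq> f ` pverts W" "{f u', f v'} \<subseteq> f ` pverts W"
      using arcs(1,2) by (auto simp: W_def)
    have II: "I u v \<inter> I u' v' = {}" using disj arcs unfolding I_def by fastforce
    fix w assume w: "w \<in> V u v \<inter> V u' v'"
    have "w \<notin> I u v"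
    proof
      assume w1: "w \<in> I u v"
      then have "w \<in> {f u', f v'}" using w V[OF arcs(2)] II by auto
      then show False using w1 I[OF arcs(1)] ends(2) by auto
    qed
    moreover have "w \<notin> I u' v'"
    proof
      assume w1: "w \<in> I u' v'"
      then have "w \<in> {f u, f v}" using w V[OF arcs(1)] II by auto
      then show False using w1 I[OF arcs(2)] ends(1) by auto
    qed
    ultimately show "w \<in> {f u, f v} \<inter> {f u', f v'}" using w V[OF arcs(1)] V[OF arcs(2)] by auto
  qed
  have int: "V Wa Wb \<inter> V Wb Wd \<subseteq> {?b}" "V Wa Wc \<inter> V Wc Wd \<subseteq> {?c}" "V Wb Wc \<inter> V Wc Wd \<subseteq> {?c}"
    "V Wa Wb \<inter> V Wb Wc \<subseteq> {?b}" "V Wa Wb \<inter> V Wc Wd \<subseteq> {}"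
    "V Wa Wb \<inter> V Wa Wc \<subseteq> {?a}" "V Wb Wd \<inter> V Wc Wd \<subseteq> {?d}" "V Wb Wd \<inter> V Wa Wc \<subseteq> {}"
    by (rule order_trans[OF capV], simp add: W_def, simp add: W_def, simp, use ne in force)+
  define D where "D = path_arcs G ?a ?d"
  have inD: "set p \<subseteq> D" if "set p \<subseteq> parcs G" "pcas ?a p ?d" "distinct (pawalk_verts ?a p)" for p
    using that path(4)[OF arcs(1)] unfolding D_def path_arcs_def apath_with_proj_iff by blast
  note app = pcas_append(1,3)[OF path(1)[OF arcs(1)] path(1)[OF arcs(3)]]
    pcas_append(1,3)[OF path(1)[OF arcs(2)] path(1)[OF arcs(4)]]
    pcas_append[OF path(1)[OF arcs(5)] path(1)[OF arcs(4)]]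
  \<comment> \<open>The concatenations along \<open>abd\<close>, \<open>acd\<close> and
    \<open>abcd\<close> are paths from \<open>a\<close> to \<open>d\<close> and cover all five
    branch paths, so \<open>D\<close> contains the whole subdivision.\<close>
  have D1: "set (P (Wa, Wb) @ P (Wb, Wd)) \<subseteq> D"
    using app(1,2) path(2,3)[OF arcs(1)] path(2,3)[OF arcs(3)] int(1) unfolding V_def by (intro inD) auto
  have D2: "set (P (Wa, Wc) @ P (Wc, Wd)) \<subseteq> D"
    using app(3,4) path(2,3)[OF arcs(2)] path(2,3)[OF arcs(4)] int(2) unfolding V_def by (intro inD) auto
  have D3: "set (P (Wa, Wb) @ P (Wb, Wc) @ P (Wc, Wd)) \<subseteq> D"
  proof (rule inD)
    have 1: "distinct (pawalk_verts ?b (P (Wb, Wc) @ P (Wc, Wd)))"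
      using app(7) path(2)[OF arcs(5)] path(2)[OF arcs(4)] int(3) unfolding V_def by auto
    have 2: "V Wa Wb \<inter> set (pawalk_verts ?b (P (Wb, Wc) @ P (Wc, Wd))) \<subseteq> {?b}"
      using app(6) int(4,5) unfolding V_def by auto
    show "distinct (pawalk_verts ?a (P (Wa, Wb) @ P (Wb, Wc) @ P (Wc, Wd)))"
      using pcas_append(3)[OF path(1)[OF arcs(1)] app(5) path(2)[OF arcs(1)] 1] 2
        unfolding V_def by blast
    show "pcas ?a (P (Wa, Wb) @ P (Wb, Wc) @ P (Wc, Wd)) ?d"
      using pcas_append(1)[OF path(1)[OF arcs(1)] app(5)] .
    show "set (P (Wa, Wb) @ P (Wb, Wc) @ P (Wc, Wd)) \<subseteq> parcs G"
      using path(3)[OF arcs(1)] path(3)[OF arcs(4)] path(3)[OF arcs(5)] by auto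
  qed
  have "D \<noteq> {}" using D1 path(6)[OF arcs(1)] by auto
  moreover have "?a \<in> pverts G" "?d \<in> pverts G" using path(4)[OF arcs(1)] path(5)[OF arcs(3)] by auto
  ultimately have "sp ?a ?d D"
    using P1 unfolding property_P1_def dsp_iff_sp path_subgraph_def D_def by auto
  then show False
  proof (rule sp_no_crossing)
    have reach: "(f x, f y) \<in> (Restr D X)\<^sup>*"
      if "(x, y) \<in> parcs W" "set (P (x, y)) \<subseteq> D" "V x y \<subseteq> X" for x y X
      using pcas_rtrancl_Restr[OF path(1)[OF that(1)] that(2)] that(3) unfolding V_def by blast
    show "(V Wa Wb \<union> V Wb Wd) \<inter> (V Wa Wc \<union> V Wc Wd) \<subseteq> {?a, ?d}" using int(5-8) by blast
    show "?b \<notin> {?a, ?d}" "?c \<notin> {?a, ?d}" using ne by auto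
    show "(?a, ?b) \<in> (Restr D (V Wa Wb \<union> V Wb Wd))\<^sup>*" using D1 by (intro reach arcs) auto
    show "(?b, ?d) \<in> (Restr D (V Wa Wb \<union> V Wb Wd))\<^sup>*" using D1 by (intro reach arcs) auto
    show "(?a, ?c) \<in> (Restr D (V Wa Wc \<union> V Wc Wd))\<^sup>*" using D2 by (intro reach arcs) auto
    show "(?c, ?d) \<in> (Restr D (V Wa Wc \<union> V Wc Wd))\<^sup>*" using D2 by (intro reach arcs) auto
    have "V Wb Wc \<subseteq> - {?a, ?d}" unfolding V' using ne I[OF arcs(5)] by (auto simp: img)
    then show "(?b, ?c) \<in> (Restr D (- {?a, ?d}))\<^sup>*" using D3 by (intro reach arcs) auto
  qed
qed

theorem theorem3:
  fixes G :: "'a pair_pre_digraph"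
  assumes "pair_digraph G"
  shows "property_P1 G \<longleftrightarrow>
    \<not> (\<exists>H :: 'a pair_pre_digraph. subgraph (with_proj H) (with_proj G) \<and> subdivision_of W H)"
proof
  assume "property_P1 G"
  then show "\<not> (\<exists>H :: 'a pair_pre_digraph. subgraph (with_proj H) (with_proj G) \<and> subdivision_of W H)"
    using subdivision_W_not_P1[OF assms] by blast
next
  assume "\<not> (\<exists>H :: 'a pair_pre_digraph. subgraph (with_proj H) (with_proj G) \<and> subdivision_of W H)"
  moreover have "pverts W = Field (parcs W)" "irrefl (parcs W)"
    by (auto simp: W_def Field_def irrefl_def)
  ultimately have "\<not> topological_minor W (parcs G)"
    using subdivision_of_topological_minor pair_digraph.pair_wf_digraph[OF assms] by blast
  then show "property_P1 G"
    using dsp_path_subgraph[OF assms] unfolding property_P1_def by (auto simp: path_subgraph_def)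
qed

end
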